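(* Let $s\ge k\ge 4$ and let $R$ be an arbitrary $k$-vertex tournament whose $\binom k2$ edges are colored with the $\binom k2$ distinct colors from $\binom{[k]}{2}$. Then the number of copies of $R$ in any $s$-vertex tournament whose edges are colored from $\binom{[k]}{2}$ is at most $g_k(s)$.
   Context: A copy of $R$ in an edge-colored tournament $H$ is a $k$-set $K$ of vertices such that $H[K]$ is isomorphic to $R$ via a bijection preserving both edge orientations and edge colors. The function $g_k$ is defined by: $g_k(s)=0$ for $0\le s<k$, and for $s\ge k\ge 3$, $g_k(s)=\max\left(\sum_{i=1}^k g_k(s_i)+\prod_{i=1}^k s_i\right)$, the maximum over all partitions $s_1+\dots+s_k=s$ into nonnegative integers with $s_i<s$ for each $i$. *)

theory Defs
  imports Main
begin

text \<open>The function g_k. For s < k (or k < 3, where it is not used) it is 0;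
  otherwise it is the maximum, over all compositions s_1 + ... + s_k = s
  (lists of length k of naturals) with every s_i < s, of
  sum_i g_k(s_i) + prod_i s_i.\<close>

function gk :: "nat \<Rightarrow> nat \<Rightarrow> nat" where
  "gk k s = (if s < k \<or> k < 3 then 0 else
     Max ((\<lambda>xs. sum_list (map (gk k) xs) + prod_list xs) `
          {xs. length xs = k \<and> sum_list xs = s \<and> (\<forall>x\<in>set xs. x < s)}))"
  by pat_completeness auto
termination
  by (relation "measure (\<lambda>(k, s). s)") auto

definition tournament :: "'a set \<Rightarrow> ('a \<Rightarrow> 'a \<Rightarrow> bool) \<Rightarrow> bool" where
  "tournament V T \<longleftrightarrow> finite V \<and> (\<forall>u\<in>V. \<not> T u u) \<and>
     (\<forall>u\<in>V. \<forall>v\<in>V. u \<noteq> v \<longrightarrow> (T u v \<longleftrightarrow> \<not> T v u))"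

definition edges :: "'a set \<Rightarrow> 'a set set" where
  "edges V = {e. e \<subseteq> V \<and> card e = 2}"

definition kpairs :: "nat \<Rightarrow> nat set set" where
  "kpairs k = {C. C \<subseteq> {1..k} \<and> card C = 2}"

definition is_copy ::
  "'a set \<Rightarrow> ('a \<Rightarrow> 'a \<Rightarrow> bool) \<Rightarrow> ('a set \<Rightarrow> 'c) \<Rightarrow>
   'b set \<Rightarrow> ('b \<Rightarrow> 'b \<Rightarrow> bool) \<Rightarrow> ('b set \<Rightarrow> 'c) \<Rightarrow> 'a set \<Rightarrow> bool" where
  "is_copy V T colH W TR colR K \<longleftrightarrow> K \<subseteq> V \<and> card K = card W \<and>
     (\<exists>f. bij_betw f K W \<and>
        (\<forall>u\<in>K. \<forall>v\<in>K. u \<noteq> v \<longrightarrow>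
            (T u v \<longleftrightarrow> TR (f u) (f v)) \<and> colH {u, v} = colR {f u, f v}))"

end

(* Every edge of the host graph fixes the roles of its two endpoints in all copies containing it, so a
   copy is an assignment g of vertices to roles with lab (g i) (g j) = i. Let h be the number of copies
   in the balanced iterated blow-up; h is at most g_k, and h(s) - h(s-1) is explicit. Consider a minimal
   counterexample with s = kq + c vertices, 0 < c <= k. Every vertex lies in more than h(s) - h(s-1) copies, since
   otherwise it could be deleted; this forces every vertex x to have a major role r(x), which it plays
   towards all but at most 1.05 q of the other vertices. Partition the vertices by major role.
   A copy that meets several classes without being a transversal with the correct roles contains at
   least two bad edges, i.e. edges between different classes with a wrong role. Few copies contain a
   given bad edge, whereas each bad edge prevents many transversals from being copies. Hence there are
   at most as many such copies as transversals lost, and the number of copies is at most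
   sum h(v_i) + prod v_i, where v_i are the class sizes. Replacing the v_i by the balanced partition does
   not decrease this expression, as the classes are nearly balanced already, so it is at most h(s). *)

theory Submission
  imports Defs "HOL-Library.FuncSet"
begin

text \<open>The function h is handled through its increments, which govern both deleting a vertex
  and moving one vertex between classes. Increments of a balanced product are again balanced
  products, so it is discretely convex and superadditive. A vertex whose partners are divided among
  several roles therefore lies in few copies; this is what produces the major role. The constants
  must fit a window. If (1+x)q partners may see a wrong role, the estimate giving the major role
  asks for 27x(1-x) >= (1+x)^3 for large q, so x above about 0.044, while for four roles the class
  bound 5q/4 tolerates x up to about 0.074. The choice is x = 1/20. For k >= 5 there is ample room:
  class sizes at most 2.1q + 1 and a union bound over pairs of roles suffice. For k = 4 these
  estimates fail, and two remedies are needed together: a sharper bound on the largest class, and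
  inclusion-exclusion over complementary pairs of roles. Either one alone still falls short in
  leading order.\<close>

section \<open>Balanced products\<close>

text \<open>\<open>bal j m\<close> is the largest product of \<open>j\<close> natural numbers with sum \<open>m\<close>: the recursion splits off
  a smallest factor of the balanced composition.\<close>

primrec bal :: "nat \<Rightarrow> nat \<Rightarrow> nat" where
  "bal 0 m = 1"
| "bal (Suc j) m = (m div Suc j) * bal j (m - m div Suc j)"

lemma div_Suc_cases:
  fixes m j :: nat
  obtains (same) "Suc m div Suc j = m div Suc j" "m mod Suc j < j" "(m - m div Suc j) div j = m div Suc j"
  | (up) "Suc m div Suc j = Suc (m div Suc j)"
proof (cases "Suc (m mod Suc j) = Suc j")
  case True
  then show ?thesis by (intro up) (simp add: div_Suc mod_Suc split: if_splits)
next
  case False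
  have lt: "m mod Suc j < j" using False by (metis less_SucE mod_less_divisor zero_less_Suc)
  have "m = m div Suc j * Suc j + m mod Suc j" by (metis div_mult_mod_eq)
  then have "m - m div Suc j = m div Suc j * j + m mod Suc j" by simp
  then have "(m - m div Suc j) div j = m div Suc j" using lt by simp
  then show ?thesis using False lt by (intro same) (simp_all add: div_Suc mod_Suc)
qed

text \<open>One more unit goes to a smallest part, of size \<open>m div Suc j\<close>; the product
  then grows by the product of the other parts, which is again balanced.\<close>

lemma bal_Suc_Suc: "bal (Suc j) (Suc m) = bal (Suc j) m + bal j (m - m div Suc j)"
proof (induction j arbitrary: m)
  case 0
  then show ?case by simp
next
  case (Suc j)
  let ?c = "m div Suc (Suc j)"
  have le: "?c \<le> m" by simp
  show ?case
  proof (cases rule: div_Suc_cases[of m "Suc j"])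
    case same
    have "bal (Suc (Suc j)) (Suc m) = ?c * bal (Suc j) (Suc (m - ?c))"
      using same le by (simp add: Suc_diff_le)
    also have "\<dots> = ?c * bal (Suc j) (m - ?c) + ?c * bal j (m - ?c - (m - ?c) div Suc j)"
      by (simp only: Suc.IH distrib_left)
    also have "\<dots> = bal (Suc (Suc j)) m + bal (Suc j) (m - ?c)"
      using same(3) by simp
    finally show ?thesis .
  next
    case up
    then show ?thesis by (simp del: bal.simps(2) add: bal.simps(2)[of "Suc j"])
  qed
qed

lemma bal_mono: "a \<le> b \<Longrightarrow> bal j a \<le> bal j b"
proof (induction b rule: dec_induct)
  case (step n)
  have "bal j n \<le> bal j (Suc n)" by (cases j) (simp_all add: bal_Suc_Suc del: bal.simps(2))
  with step show ?case by linarith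
qed simp

lemma diff_div_mono:
  fixes a b j :: nat
  assumes "a \<le> b"
  shows "a - a div Suc j \<le> b - b div Suc j"
  using assms
proof (induction b rule: dec_induct)
  case (step n)
  have "Suc n div Suc j \<le> Suc (n div Suc j)" by (metis div_Suc le_SucI le_refl)
  then have "n - n div Suc j \<le> Suc n - Suc n div Suc j"
    by (metis Suc_diff_le diff_Suc_Suc diff_le_mono2 div_le_dividend)
  with step show ?case by linarith
qed simp

text \<open>The increments found in \<open>bal_Suc_Suc\<close> are balanced products of sums that
  grow with the argument, so they are nondecreasing.\<close>

lemma bal_convex: "a \<le> b \<Longrightarrow> bal j (a + c) + bal j b \<le> bal j a + bal j (b + c)"
proof (induction c)
  case (Suc c)
  show ?case
  proof (cases j)
    case (Suc j')
    have "bal j' (a + c - (a + c) div Suc j') \<le> bal j' (b + c - (b + c) div Suc j')"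
      using Suc.prems by (intro bal_mono diff_div_mono) simp
    then show ?thesis using Suc.IH[OF Suc.prems] Suc
      by (simp add: bal_Suc_Suc del: bal.simps(2))
  qed simp
qed simp

lemma bal_0: "0 < j \<Longrightarrow> bal j 0 = 0"
  by (cases j) auto

lemma bal_superadd: "0 < j \<Longrightarrow> bal j a + bal j b \<le> bal j (a + b)"
  using bal_convex[of 0 b j a] by (simp add: bal_0 add.commute)

lemma bal_sum_le: "finite A \<Longrightarrow> 0 < j \<Longrightarrow> (\<Sum>i\<in>A. bal j (f i)) \<le> bal j (\<Sum>i\<in>A. f i)"
proof (induction A rule: finite_induct)
  case (insert x F)
  then have "(\<Sum>i\<in>insert x F. bal j (f i)) \<le> bal j (f x) + bal j (sum f F)" by simp
  also have "\<dots> \<le> bal j (f x + sum f F)" using insert by (intro bal_superadd)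
  finally show ?case using insert by simp
qed (simp add: bal_0)

text \<open>Induction on the sum: lowering a largest factor by one loses the product of the others.
  A maximum is at least the average, so the others have sum at most \<open>m - m div Suc j\<close>,
  and the loss is at most the increment of \<open>bal\<close>.\<close>

lemma prod_le_bal:
  fixes f :: "'b \<Rightarrow> nat"
  assumes "finite A"
  shows "prod f A \<le> bal (card A) (sum f A)"
proof -
  have "finite A \<Longrightarrow> sum f A = n \<Longrightarrow> prod f A \<le> bal (card A) n" for n and f :: "'b \<Rightarrow> nat" and A
  proof (induction n arbitrary: A f rule: less_induct)
    case (less n)
    show ?case
    proof (cases "\<exists>a\<in>A. f a \<noteq> 0")
      case False
      show ?thesis
      proof (cases "A = {}")
        case ne: False
        then obtain x where "x \<in> A" "f x = 0" using False by auto
        then have "prod f A = 0" using less.prems(1) by (intro prod_zero) auto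
        then show ?thesis by simp
      next
        case True
        then show ?thesis by simp
      qed
    next
      case True
      define mx where "mx = Max (f ` A)"
      have ne: "A \<noteq> {}" using True by auto
      obtain a where a: "a \<in> A" "f a = mx"
      proof -
        have "mx \<in> f ` A" unfolding mx_def using less.prems(1) ne by (intro Max_in) auto
        then show ?thesis using that by auto
      qed
      have ub: "f x \<le> mx" if "x \<in> A" for x
        unfolding mx_def by (rule Max_ge) (use that less.prems(1) in auto)
      obtain a' where "a' \<in> A" "f a' \<noteq> 0" using True by blast
      then have "mx > 0" using ub[of a'] by linarith
      then obtain c where c: "f a = Suc c" using a(2) by (cases mx) auto
      obtain j where j: "card A = Suc j" using ne less.prems(1) by (cases "card A") auto
      have cA: "card (A - {a}) = j" using a(1) less.prems(1) j by simp
      define m where "m = sum f A - 1"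
      have sA: "sum f A = Suc c + sum f (A - {a})" using sum.remove[OF less.prems(1) a(1), of f] c by simp
      then have m: "sum f A = Suc m" unfolding m_def by simp
      let ?g = "f(a := c)"
      have agree: "f x = ?g x" if "x \<in> A - {a}" for x using that by simp
      have eq1: "prod f (A - {a}) = prod ?g (A - {a})"
        by (rule prod.cong[OF refl agree])
      have eq2: "sum f (A - {a}) = sum ?g (A - {a})"
        by (rule sum.cong[OF refl agree])
      have sg: "sum ?g A = m"
        using sum.remove[OF less.prems(1) a(1), of ?g] sA m unfolding eq2 by simp
      have e1: "prod f A = Suc c * prod f (A - {a})" using prod.remove[OF less.prems(1) a(1), of f] c by simp
      then have e2: "prod f A = prod ?g A + prod f (A - {a})"
        using prod.remove[OF less.prems(1) a(1), of ?g] unfolding eq1 by simp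
      have e3: "prod ?g A \<le> bal (Suc j) m"
        using less.IH[OF _ less.prems(1), of m ?g] less.prems(2) sg m j by simp
      have e4: "prod f (A - {a}) \<le> bal j (sum f (A - {a}))"
        using less.IH[of "sum f (A - {a})" "A - {a}" f] less.prems sA cA by simp
      have e5: "bal j (sum f (A - {a})) \<le> bal j (m - m div Suc j)"
      proof (rule bal_mono)
        have "sum f A \<le> card A * mx" using sum_bounded_above[of A f mx] ub by simp
        then have "m < Suc c * Suc j" using m j a c by (simp add: mult.commute)
        then have "m div Suc j < Suc c" by (rule less_mult_imp_div_less)
        then show "sum f (A - {a}) \<le> m - m div Suc j" using sA m by simp
      qed
      have "prod f A \<le> bal (Suc j) m + bal j (m - m div Suc j)"
        using e2 e3 e4 e5 by linarith
      then show ?thesis using m j less.prems(2) by (simp only: bal_Suc_Suc)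
    qed
  qed
  then show ?thesis using assms by blast
qed

section \<open>Explicit bounds on balanced products\<close>

lemma bal_ge:
  assumes "j * c + e = m"
  shows "c ^ j \<le> bal j m"
proof -
  have "c ^ j \<le> bal j (j * c)" using prod_le_bal[of "{..<j}" "\<lambda>_. c"] by simp
  also have "\<dots> \<le> bal j m" using assms by (intro bal_mono) simp
  finally show ?thesis .
qed

lemma bal_le_div_mult: "bal (Suc j) m \<le> (m div Suc j) * bal j m"
  using bal_mono[of "m - m div Suc j" m j] by simp

lemma bal_2: "4 * bal 2 m \<le> m ^ 2"
proof -
  define c where "c = m div 2"
  define e where "e = m mod 2"
  have m: "m = 2 * c + e" unfolding c_def e_def by simp
  have d: "m - c = c + e" using m by simp
  have "bal 2 m = c * bal (Suc 0) (m - c)" unfolding c_def numeral_2_eq_2 by (simp only: bal.simps)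
  then have b: "bal 2 m = c * (c + e)" unfolding d by simp
  have "m ^ 2 = 4 * (c * (c + e)) + e ^ 2"
    unfolding m by (simp add: power2_eq_square algebra_simps)
  then show ?thesis unfolding b by simp
qed

lemma bal_3: "27 * bal 3 m \<le> m ^ 3"
proof -
  define c where "c = m div 3"
  define e where "e = m mod 3"
  have m: "m = 3 * c + e" unfolding c_def e_def by simp
  have d: "m - c = 2 * c + e" using m by simp
  have "bal 3 m = c * bal 2 (m - c)" unfolding c_def numeral_3_eq_3 numeral_2_eq_2 by (simp only: bal.simps)
  then have b: "bal 3 m = c * bal 2 (2 * c + e)" unfolding d .
  have "c * (4 * bal 2 (2 * c + e)) \<le> c * (2 * c + e) ^ 2" by (rule mult_le_mono2[OF bal_2])
  then have "4 * bal 3 m \<le> c * (2 * c + e) ^ 2" unfolding b by simp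
  moreover have "4 * m ^ 3 = 27 * (c * (2 * c + e) ^ 2) + (9 * c * e ^ 2 + 4 * e ^ 3)"
    unfolding m by (simp add: power2_eq_square power3_eq_cube algebra_simps)
  ultimately show ?thesis by linarith
qed

lemma bal_4: "256 * bal 4 m \<le> m ^ 4"
proof -
  define c where "c = m div 4"
  define e where "e = m mod 4"
  have m: "m = 4 * c + e" unfolding c_def e_def by simp
  have d: "m - c = 3 * c + e" using m by simp
  have "4 = Suc 3" by simp
  then have "bal 4 m = c * bal 3 (m - c)" unfolding c_def by (simp only: bal.simps)
  then have b: "bal 4 m = c * bal 3 (3 * c + e)" unfolding d .
  have "c * (27 * bal 3 (3 * c + e)) \<le> c * (3 * c + e) ^ 3" by (rule mult_le_mono2[OF bal_3])
  then have "27 * bal 4 m \<le> c * (3 * c + e) ^ 3" unfolding b by simp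
  moreover have "27 * m ^ 4 = 256 * (c * (3 * c + e) ^ 3) + (288 * (c * c * e * e) + 176 * (c * e * e * e) + 27 * (e * e * e * e))"
    unfolding m by (simp add: power3_eq_cube power4_eq_xxxx algebra_simps)
  ultimately show ?thesis by linarith
qed

lemma bal_le_power: "m \<le> j * c \<Longrightarrow> bal j m \<le> c ^ j"
proof (induction j arbitrary: m)
  case (Suc j)
  define d where "d = m div Suc j"
  have dc: "d \<le> c" unfolding d_def
    using div_le_mono[OF Suc.prems, of "Suc j"] by (simp only: nonzero_mult_div_cancel_left[OF nat.distinct(2)])
  have m: "m = Suc j * d + m mod Suc j" unfolding d_def by (simp only: mult_div_mod_eq)
  have e: "m mod Suc j \<le> j" by (metis less_Suc_eq_le mod_less_divisor zero_less_Suc)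
  have "m - d \<le> j * c"
  proof (cases "d = c")
    case True
    then show ?thesis using Suc.prems by simp
  next
    case False
    have "m - d = j * d + m mod Suc j" using m by simp
    also have "\<dots> \<le> j * Suc d" using e by simp
    also have "\<dots> \<le> j * c" using dc False by (intro mult_le_mono) auto
    finally show ?thesis .
  qed
  then show ?case using Suc.IH dc unfolding bal.simps d_def[symmetric] by (simp add: mult_le_mono)
qed simp

text \<open>The parts \<open>(m + i) div j\<close> list the balanced composition explicitly, which
  is the form needed for a witness in the maximum defining \<open>gk\<close>.\<close>

lemma prod_lessThan_eq_bal: "(\<Prod>i<j. (m + i) div j) = bal j m"
proof (induction j arbitrary: m)
  case (Suc j)
  define q r where "q = m div Suc j" and "r = m mod Suc j"
  have m: "m = Suc j * q + r" unfolding q_def r_def by (simp only: mult_div_mod_eq)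
  have r: "r \<le> j" unfolding r_def by (metis less_Suc_eq_le mod_less_divisor zero_less_Suc)
  have mq: "m - q = j * q + r" using m by simp
  have shift: "(m + Suc i) div Suc j = (m - q + i) div j" if "i < j" for i
  proof -
    have a: "(m + Suc i) div Suc j = q + (r + Suc i) div Suc j"
      using m by (metis add.assoc div_mult_self4 mult.commute nat.distinct(1))
    have b: "(m - q + i) div j = q + (r + i) div j"
      using mq that by (metis add.assoc div_mult_self4 mult.commute not_less_zero)
    have "(r + Suc i) div Suc j = (r + i) div j"
    proof (cases "r + i < j")
      case True
      then show ?thesis by simp
    next
      case False
      have "(r + i) div j = 1"
        using False r that by (intro div_nat_eqI) auto
      moreover have "(r + Suc i) div Suc j = 1"
        using False r that by (intro div_nat_eqI) auto
      ultimately show ?thesis by simp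
    qed
    then show ?thesis using a b by simp
  qed
  have "(\<Prod>i<Suc j. (m + i) div Suc j) = q * (\<Prod>i<j. (m + Suc i) div Suc j)"
    unfolding q_def by (subst prod.lessThan_Suc_shift) simp
  also have "(\<Prod>i<j. (m + Suc i) div Suc j) = (\<Prod>i<j. (m - q + i) div j)"
    using shift by (intro prod.cong) auto
  finally show ?case by (simp only: Suc.IH bal.simps q_def)
qed simp

section \<open>The value of the balanced iterated construction\<close>

text \<open>\<open>hb k s\<close> is the number of copies in the iterated blow-up all of whose partitions are balanced, and
  \<open>dl k t\<close> is its increment from \<open>t\<close> to \<open>t + 1\<close> vertices. Since \<open>hb k s \<le> gk k s\<close>, it suffices to
  bound the number of copies by \<open>hb k s\<close>.\<close>

function dl :: "nat \<Rightarrow> nat \<Rightarrow> nat" where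
  "dl k t = (if t = 0 \<or> k < 2 then 0 else bal (k - 1) (t - t div k) + dl k (t div k))"
  by pat_completeness auto
termination by (relation "measure snd") auto

declare dl.simps [simp del]

definition hb :: "nat \<Rightarrow> nat \<Rightarrow> nat" where
  "hb k s = (\<Sum>t<s. dl k t)"

lemma hb_0 [simp]: "hb k 0 = 0" and hb_Suc: "hb k (Suc s) = hb k s + dl k s"
  by (simp_all add: hb_def)

lemma dl_eq: "2 \<le> k \<Longrightarrow> dl k t = bal (k - 1) (t - t div k) + dl k (t div k)"
  by (cases "t = 0") (simp_all add: dl.simps[of k t] dl.simps[of k 0] bal_0)

lemma bal_eq_0: "m < j \<Longrightarrow> bal j m = 0"
  by (cases j) simp_all

lemma hb_eq_0:
  assumes "s < k"
  shows "hb k s = 0"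
proof -
  have "dl k t = 0" if "t < k - 1" for t
  proof (cases "2 \<le> k")
    case True
    then show ?thesis using that dl_eq[OF True, of t] bal_eq_0[of t "k - 1"] by (simp add: dl.simps[of k 0])
  qed (simp add: dl.simps)
  then show ?thesis using assms unfolding hb_def by simp
qed

lemma sum_parts_Suc:
  fixes F :: "nat \<Rightarrow> nat"
  assumes "0 < k"
  shows "(\<Sum>i<k. F ((Suc s + i) div k)) + F (s div k) = (\<Sum>i<k. F ((s + i) div k)) + F (Suc (s div k))"
proof -
  obtain j where k: "k = Suc j" using assms by (cases k) auto
  have "(\<Sum>i<k. F ((Suc s + i) div k)) = (\<Sum>i<j. F ((s + Suc i) div k)) + F ((s + k) div k)"
    unfolding k by simp
  moreover have "(\<Sum>i<k. F ((s + i) div k)) = F (s div k) + (\<Sum>i<j. F ((s + Suc i) div k))"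
    by (subst k, subst sum.lessThan_Suc_shift) simp
  moreover have "(s + k) div k = Suc (s div k)" using assms by (simp add: div_add_self2)
  ultimately show ?thesis by simp
qed

lemma sum_parts:
  fixes s k :: nat
  shows "0 < k \<Longrightarrow> (\<Sum>i<k. (s + i) div k) = s"
proof (induction s)
  case (Suc s)
  then show ?case using sum_parts_Suc[of k "\<lambda>x. x" s] by simp
qed simp

text \<open>Passing from \<open>s\<close> to \<open>s + 1\<close> enlarges one smallest part
  \<open>s div k\<close>. The product gains the transversals through the new vertex and the part
  itself gains \<open>dl k (s div k)\<close>; these are the two summands in the recursion of
  \<open>dl\<close>.\<close>

lemma hb_balanced:
  assumes "2 \<le> k"
  shows "hb k s = (\<Sum>i<k. hb k ((s + i) div k)) + bal k s"
proof (induction s)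
  case 0
  then show ?case using assms by (simp add: bal_0)
next
  case (Suc s)
  obtain j where k: "k = Suc j" using assms by (cases k) auto
  have b: "bal k (Suc s) = bal k s + bal (k - 1) (s - s div k)"
    unfolding k by (simp add: bal_Suc_Suc del: bal.simps(2))
  have "(\<Sum>i<k. hb k ((Suc s + i) div k)) = (\<Sum>i<k. hb k ((s + i) div k)) + dl k (s div k)"
    using sum_parts_Suc[of k "hb k" s] assms by (simp add: hb_Suc)
  then show ?case using Suc.IH b dl_eq[OF assms, of s] by (simp add: hb_Suc)
qed

lemma hb_le_gk:
  assumes "3 \<le> k"
  shows "hb k s \<le> gk k s"
proof (induction s rule: less_induct)
  case (less s)
  show ?case
  proof (cases "s < k")
    case True
    then show ?thesis by (simp add: hb_eq_0)
  next
    case False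
    define xs where "xs = map (\<lambda>i. (s + i) div k) [0..<k]"
    have lt: "(s + i) div k < s" if "i < k" for i
    proof -
      have "s + i < s * 2" using that False by simp
      also have "\<dots> \<le> s * k" using assms by (intro mult_le_mono) auto
      finally show ?thesis by (intro less_mult_imp_div_less)
    qed
    let ?X = "{xs. length xs = k \<and> sum_list xs = s \<and> (\<forall>x\<in>set xs. x < s)}"
    have fin: "finite ?X"
      by (rule finite_subset[OF _ finite_lists_length_eq[of "{..<s}" k]]) auto
    have sl: "sum_list (map g [0..<k]) = (\<Sum>i<k. g i)" for g :: "nat \<Rightarrow> nat"
      by (simp add: interv_sum_list_conv_sum_set_nat atLeast0LessThan)
    have pl: "prod_list (map g [0..<k]) = (\<Prod>i<k. g i)" for g :: "nat \<Rightarrow> nat"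
      by (induction k) auto
    have "xs \<in> ?X" using lt assms unfolding xs_def by (auto simp: sl sum_parts)
    then have "sum_list (map (gk k) xs) + prod_list xs
        \<le> Max ((\<lambda>xs. sum_list (map (gk k) xs) + prod_list xs) ` ?X)"
      using fin by (intro Max_ge) auto
    also have "\<dots> = gk k s" using False assms by (subst gk.simps) auto
    finally have "(\<Sum>i<k. gk k ((s + i) div k)) + bal k s \<le> gk k s"
      by (simp add: xs_def comp_def sl pl prod_lessThan_eq_bal)
    moreover have "(\<Sum>i<k. hb k ((s + i) div k)) \<le> (\<Sum>i<k. gk k ((s + i) div k))"
      using less.IH lt by (intro sum_mono) auto
    ultimately show ?thesis using hb_balanced[of k s] assms by linarith
  qed
qed

section \<open>Growth of the increments and the exchange argument\<close>

lemma dl_Suc_le: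
  assumes "2 \<le> k"
  shows "dl k (Suc t) \<le> dl k t + (t div k + 1) ^ (k - 2)"
proof (induction t rule: less_induct)
  case (less t)
  obtain j where k: "k = Suc (Suc j)" using assms by (metis add_2_eq_Suc le_Suc_ex)
  define q where "q = t div k"
  have qt: "q \<le> t" unfolding q_def by simp
  show ?case
  proof (cases "Suc t mod k = 0")
    case True
    \<comment> \<open>Here \<open>Suc t - Suc q = t - q\<close>, so the product term does not change
      and only the recursive term grows. In the other case only the product term grows, by a product
      of \<open>k - 2\<close> parts of size at most \<open>q + 1\<close>.\<close>
    then have d: "Suc t div k = Suc q" unfolding q_def by (simp add: div_Suc)
    have "q < t"
    proof -
      have "t \<noteq> 0" using True assms by (cases "t = 0") (auto simp: k)
      then show ?thesis unfolding q_def using assms by (intro div_less_dividend) auto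
    qed
    then have "dl k (Suc q) \<le> dl k q + (q div k + 1) ^ (k - 2)" by (rule less.IH)
    also have "\<dots> \<le> dl k q + (q + 1) ^ (k - 2)" by (intro add_left_mono power_mono) auto
    finally show ?thesis using dl_eq[OF assms, of t] dl_eq[OF assms, of "Suc t"] d
      unfolding q_def by simp
  next
    case False
    then have d: "Suc t div k = q" unfolding q_def by (simp add: div_Suc)
    define m where "m = t - q"
    have m: "m = (k - 1) * q + t mod k"
    proof -
      have "t = k * q + t mod k" unfolding q_def by simp
      then show ?thesis unfolding m_def k by simp
    qed
    have "t mod k \<noteq> Suc j" using False by (auto simp: k mod_Suc)
    moreover have "t mod k < k" using assms by simp
    ultimately have r: "t mod k \<le> j" unfolding k by linarith
    have mm: "m = Suc j * q + t mod k" using m unfolding k by simp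
    have "m div Suc j = q" using r unfolding mm by (intro div_nat_eqI) auto
    then have "m - m div Suc j \<le> j * (q + 1)" using r unfolding mm by simp
    then have "bal j (m - m div Suc j) \<le> (q + 1) ^ j" by (rule bal_le_power)
    moreover have "bal (Suc j) (Suc m) = bal (Suc j) m + bal j (m - m div Suc j)" by (rule bal_Suc_Suc)
    moreover have "dl k (Suc t) = bal (Suc j) (Suc m) + dl k q"
      using dl_eq[OF assms, of "Suc t"] d qt unfolding m_def k by (simp add: Suc_diff_le del: bal.simps(2))
    moreover have "dl k t = bal (Suc j) m + dl k q"
      using dl_eq[OF assms, of t] unfolding m_def k q_def by (simp del: bal.simps(2))
    ultimately show ?thesis unfolding q_def k by simp
  qed
qed

lemma dl_diff_le:
  assumes "2 \<le> k" and "a \<le> b" and "((b - 1) div k + 1) ^ (k - 2) \<le> X"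
  shows "dl k b \<le> dl k a + (b - a) * X"
  using assms(2,3)
proof (induction b rule: dec_induct)
  case (step n)
  have "((n - 1) div k + 1) ^ (k - 2) \<le> (n div k + 1) ^ (k - 2)"
    by (intro power_mono add_right_mono div_le_mono) auto
  then have "dl k n \<le> dl k a + (n - a) * X" using step by simp
  moreover have "dl k (Suc n) \<le> dl k n + X" using dl_Suc_le[OF assms(1), of n] step by simp
  moreover have "(Suc n - a) * X = (n - a) * X + X" using step by (simp add: Suc_diff_le)
  ultimately show ?case by linarith
qed simp

text \<open>On the two sizes \<open>c\<close> and \<open>Suc c\<close> the function
  \<open>hb k\<close> is affine with slope \<open>dl k c\<close>. Hence two nearly balanced families
  with equally many members and equal sum have equal totals, without matching their members.\<close>

lemma sum_hb_near:
  assumes "finite A" and "\<And>i. i \<in> A \<Longrightarrow> v i = c \<or> v i = Suc c"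
  shows "(\<Sum>i\<in>A. hb k (v i)) + card A * c * dl k c = card A * hb k c + (\<Sum>i\<in>A. v i) * dl k c"
  using assms
proof (induction A rule: finite_induct)
  case (insert x F)
  have "v x = c \<or> v x = Suc c" using insert by simp
  then have "hb k (v x) + c * dl k c = hb k c + v x * dl k c" by (auto simp: hb_Suc)
  then show ?case using insert by (simp add: algebra_simps)
qed simp

lemma parts_near:
  fixes s k :: nat
  assumes "i < k"
  shows "(s + i) div k = s div k \<or> (s + i) div k = Suc (s div k)"
proof -
  have "s div k \<le> (s + i) div k" by (simp add: div_le_mono)
  moreover have "(s + i) div k \<le> (s + k) div k" using assms by (simp add: div_le_mono)
  moreover have "(s + k) div k = Suc (s div k)" using assms by (simp add: div_add_self2)
  ultimately show ?thesis by linarith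
qed

text \<open>Moving a unit from a largest to a smallest class lowers the sum of squares, and
  \<open>big\<close> survives because the product grows while the maximum does not. The gain in the
  product must pay for the loss in the \<open>hb\<close> terms, which convexity of \<open>hb\<close>
  makes unavoidable; \<open>X\<close> bounds the slope of \<open>dl\<close> in the relevant
  range.\<close>

lemma hb_exchange:
  fixes v :: "'b \<Rightarrow> nat"
  assumes W: "finite W" "card W = k" "2 \<le> k"
    and q: "q = (sum v W - 1) div k" "1 \<le> q"
    and B: "\<And>i. i \<in> W \<Longrightarrow> v i \<le> B" "((B - 2) div k + 1) ^ (k - 2) \<le> X"
    and big: "\<And>i. i \<in> W \<Longrightarrow> v i * (q * X) \<le> prod v W"
  shows "(\<Sum>i\<in>W. hb k (v i)) + prod v W \<le> hb k (sum v W)"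
proof -
  have X1: "1 \<le> X"
  proof -
    have "1 \<le> ((B - 2) div k + 1) ^ (k - 2)" by simp
    then show ?thesis using B(2) by (rule le_trans)
  qed
  have neW: "W \<noteq> {}" using W by auto
  define s where "s = sum v W"
  have "sum v W = s \<Longrightarrow> (\<And>i. i \<in> W \<Longrightarrow> v i \<le> B) \<Longrightarrow> (\<And>i. i \<in> W \<Longrightarrow> v i * (q * X) \<le> prod v W) \<Longrightarrow>
    (\<Sum>i\<in>W. hb k (v i)) + prod v W \<le> hb k s" for v
  proof (induction "\<Sum>i\<in>W. v i ^ 2" arbitrary: v rule: less_induct)
    case less
    define mx where "mx = Max (v ` W)"
    define mn where "mn = Min (v ` W)"
    have "mx \<in> v ` W" unfolding mx_def using W neW by (intro Max_in) auto
    then obtain a where a: "a \<in> W" "v a = mx" by auto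
    have "mn \<in> v ` W" unfolding mn_def using W neW by (intro Min_in) auto
    then obtain b where b: "b \<in> W" "v b = mn" by auto
    have mx: "v i \<le> v a" if "i \<in> W" for i unfolding a(2) mx_def by (rule Max_ge) (use that W in auto)
    have mn: "v b \<le> v i" if "i \<in> W" for i unfolding b(2) mn_def by (rule Min_le) (use that W in auto)
    show ?case
    proof (cases "v a \<le> Suc (v b)")
      case True
      define c where "c = v b"
      have near: "v i = c \<or> v i = Suc c" if "i \<in> W" for i
        using mx[OF that] mn[OF that] True unfolding c_def by linarith
      have "(\<Sum>i\<in>W. hb k (v i)) = (\<Sum>i<k. hb k ((s + i) div k))"
      proof -
        have sb: "sum v W < k * Suc c"
        proof -
          have "sum v W = c + sum v (W - {b})" using W b(1) sum.remove[of W b v] c_def by simp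
          also have "sum v (W - {b}) \<le> (k - 1) * Suc c"
            using sum_bounded_above[of "W - {b}" v "Suc c"] near W b(1) by fastforce
          finally show ?thesis using W by (cases k) auto
        qed
        have "k * c \<le> sum v W" using sum_bounded_below[of W c v] mn W unfolding c_def by simp
        then have c: "s div k = c" using sb less.prems(1)
          by (intro div_nat_eqI) (auto simp: mult.commute)
        have "(\<Sum>i\<in>W. hb k (v i)) + k * c * dl k c = k * hb k c + s * dl k c"
          using sum_hb_near[of W v c k] W near less.prems(1) by simp
        moreover have "(\<Sum>i<k. hb k ((s + i) div k)) + k * c * dl k c = k * hb k c + s * dl k c"
          using sum_hb_near[of "{..<k}" "\<lambda>i. (s + i) div k" c k] parts_near[of _ k s] W c
          by (simp add: sum_parts)
        ultimately show ?thesis by linarith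
      qed
      moreover have "prod v W \<le> bal k s" using prod_le_bal[of W v] W less.prems(1) by simp
      ultimately show ?thesis using hb_balanced[of k s] W by linarith
    next
      case False
      then have ab: "v b + 2 \<le> v a" by simp
      then have ne: "a \<noteq> b" by auto
      \<comment> \<open>The move replaces sizes differing by \<open>d + 2\<close> by sizes differing
        by \<open>d\<close>, so the product gains \<open>(d + 1) * P\<close> and the
        \<open>hb\<close> terms lose \<open>dl k (v a - 1) - dl k (v b)\<close>.\<close>
      define d where "d = v a - v b - 2"
      have d: "v a = v b + Suc (Suc d)" using ab unfolding d_def by simp
      define U where "U = W - {a} - {b}"
      have U: "finite U" "a \<notin> U" "b \<notin> U" using W unfolding U_def by auto
      have WU: "W = insert a (insert b U)" using a b unfolding U_def by auto
      have split_sum: "sum f W = f a + (f b + sum f U)" for f :: "'b \<Rightarrow> nat"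
        unfolding WU using U ne by simp
      have split_prod: "prod f W = f a * (f b * prod f U)" for f :: "'b \<Rightarrow> nat"
        unfolding WU using U ne by simp
      define P where "P = prod v U"
      define u where "u = v(a := v b + Suc d, b := Suc (v b))"
      have u: "u a = v b + Suc d" "u b = Suc (v b)" unfolding u_def using ne by auto
      have uU: "u i = v i" if "i \<in> U" for i using that U unfolding u_def by auto
      have sumU: "(\<Sum>i\<in>U. f (u i)) = (\<Sum>i\<in>U. f (v i))" for f :: "nat \<Rightarrow> nat"
        by (rule sum.cong) (simp_all only: uU)
      have prodU: "prod u U = P" unfolding P_def by (rule prod.cong) (simp_all only: uU)
      have su: "sum u W = s"
        using split_sum[of u] split_sum[of v] sumU[of "\<lambda>x. x"] u d less.prems(1) by simp
      have pu: "prod u W = prod v W + Suc d * P"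
        unfolding split_prod[of u] split_prod[of v] prodU P_def[symmetric] u d
        by (simp add: algebra_simps)
      have sq: "(\<Sum>i\<in>W. u i ^ 2) < (\<Sum>i\<in>W. v i ^ 2)"
      proof -
        have "u a ^ 2 + u b ^ 2 < v a ^ 2 + v b ^ 2"
          unfolding u d by (simp add: power2_eq_square algebra_simps)
        then show ?thesis
          using split_sum[of "\<lambda>i. u i ^ 2"] split_sum[of "\<lambda>i. v i ^ 2"] sumU[of "\<lambda>x. x ^ 2"] by simp
      qed
      have vbq: "v b \<le> q"
      proof -
        have "k * v b \<le> s - 1"
        proof -
          have "sum v (W - {a}) \<ge> (k - 1) * v b"
            using sum_bounded_below[of "W - {a}" "v b" v] mn W a(1) by simp
          then have "s \<ge> v a + (k - 1) * v b" using sum.remove[of W a v] W a(1) less.prems(1) by simp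
          moreover have "k * v b = v b + (k - 1) * v b" using W by (cases k) auto
          ultimately show ?thesis using ab by linarith
        qed
        then have "(k * v b) div k \<le> (s - 1) div k" by (rule div_le_mono)
        then show ?thesis using q W s_def by simp
      qed
      \<comment> \<open>Cancelling \<open>v a\<close> in \<open>big\<close> leaves
        \<open>q * X \<le> v b * P\<close>. The smallest class has at most \<open>q\<close> members,
        so a unit of product gain is worth at least \<open>X\<close>.\<close>
      have PX: "X \<le> P"
      proof -
        have "v a * (q * X) \<le> v a * (v b * P)"
          using less.prems(3)[OF a(1)] unfolding split_prod P_def .
        then have le: "q * X \<le> v b * P" using ab by simp
        also have "\<dots> \<le> q * P" using vbq by (rule mult_le_mono1)
        finally show ?thesis using q(2) by simp
      qed
      have uB: "u i \<le> B" if "i \<in> W" for i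
      proof -
        have "u i \<le> v i \<or> u i \<le> v a" using u d ne uU[of i] that unfolding WU by auto
        then show ?thesis using less.prems(2)[OF that] less.prems(2)[OF a(1)] by linarith
      qed
      have ubig: "u i * (q * X) \<le> prod u W" if "i \<in> W" for i
      proof -
        have "u i \<le> v a" using u d uU[of i] mx[of i] that unfolding WU by auto
        then have "u i * (q * X) \<le> v a * (q * X)" by (rule mult_le_mono1)
        then show ?thesis using less.prems(3)[OF a(1)] pu by linarith
      qed
      have IH: "(\<Sum>i\<in>W. hb k (u i)) + prod u W \<le> hb k s"
        by (rule less.hyps[OF sq su uB ubig])
      have "dl k (v b + Suc d) \<le> dl k (v b) + Suc d * X"
      proof -
        \<comment> \<open>The last step of \<open>dl\<close> involved starts at
          \<open>v a - 2\<close>, which explains \<open>B - 2\<close> in the hypothesis.\<close>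
        have "v b + Suc d - 1 \<le> B - 2" using less.prems(2)[OF a(1)] d by simp
        then have "((v b + Suc d - 1) div k + 1) ^ (k - 2) \<le> ((B - 2) div k + 1) ^ (k - 2)"
          by (intro power_mono add_right_mono div_le_mono) auto
        then show ?thesis using dl_diff_le[of k "v b" "v b + Suc d" X] W B(2) by simp
      qed
      also have "Suc d * X \<le> Suc d * P" using PX by (rule mult_le_mono2)
      finally have D: "dl k (v b + Suc d) \<le> dl k (v b) + Suc d * P" by simp
      have "hb k (v a) = hb k (u a) + dl k (v b + Suc d)" "hb k (u b) = hb k (v b) + dl k (v b)"
        unfolding u d by (simp_all add: hb_Suc)
      then have "(\<Sum>i\<in>W. hb k (v i)) + prod v W \<le> (\<Sum>i\<in>W. hb k (u i)) + prod u W"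
        using split_sum[of "\<lambda>i. hb k (u i)"] split_sum[of "\<lambda>i. hb k (v i)"] sumU[of "hb k"] pu D
        by linarith
      then show ?thesis using IH by linarith
    qed
  qed
  then show ?thesis using B(1) big s_def by blast
qed

section \<open>Numerical estimates\<close>

lemma power_mult_le_bal: "q ^ j * e \<le> bal (Suc j) (j * q + e)"
proof -
  have "(\<Prod>i<Suc j. if i < j then q else e) = q ^ j * e"
    and "(\<Sum>i<Suc j. if i < j then q else e) = j * q + e" by simp_all
  then show ?thesis using prod_le_bal[of "{..<Suc j}" "\<lambda>i. if i < j then q else e"] by simp
qed

text \<open>Below \<open>Suc (Suc j) * q\<close>, each of the \<open>t\<close> unit steps loses a
  balanced product of \<open>Suc j\<close> parts with sum at least
  \<open>j * q + (q + 1 - t)\<close>. Convexity carries the total loss to any larger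
  \<open>m\<close>.\<close>

lemma bal_decrement:
  assumes "t \<le> q" and "Suc (Suc j) * q \<le> m"
  shows "bal (Suc (Suc j)) (m - t) + t * (q ^ j * (q + 1 - t)) \<le> bal (Suc (Suc j)) m"
proof -
  define n where "n = Suc (Suc j) * q"
  have qn: "t \<le> n" using assms(1) unfolding n_def by simp
  have "i \<le> t \<Longrightarrow> bal (Suc (Suc j)) (n - i) + i * (q ^ j * (q + 1 - t)) \<le> bal (Suc (Suc j)) n" for i
  proof (induction i)
    case (Suc i)
    define l where "l = n - Suc i"
    have l: "n - i = Suc l" using Suc.prems qn unfolding l_def by simp
    have "l < q * Suc (Suc j)" using l unfolding n_def by (simp add: mult.commute)
    then have "l div Suc (Suc j) < q" by (rule less_mult_imp_div_less)
    then have "j * q + (q + 1 - t) \<le> l - l div Suc (Suc j)"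
      using Suc.prems assms(1) unfolding l_def n_def by simp
    then have "bal (Suc j) (j * q + (q + 1 - t)) \<le> bal (Suc j) (l - l div Suc (Suc j))"
      by (rule bal_mono)
    then have "q ^ j * (q + 1 - t) \<le> bal (Suc j) (l - l div Suc (Suc j))"
      using power_mult_le_bal[of q j "q + 1 - t"] by linarith
    moreover have "bal (Suc (Suc j)) (n - i) = bal (Suc (Suc j)) l + bal (Suc j) (l - l div Suc (Suc j))"
      unfolding l by (rule bal_Suc_Suc)
    moreover have "bal (Suc (Suc j)) (n - i) + i * (q ^ j * (q + 1 - t)) \<le> bal (Suc (Suc j)) n"
      using Suc by simp
    ultimately show ?case unfolding l_def[symmetric] mult_Suc by linarith
  qed simp
  then have "bal (Suc (Suc j)) (n - t) + t * (q ^ j * (q + 1 - t)) \<le> bal (Suc (Suc j)) n" by blast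
  moreover have "bal (Suc (Suc j)) n + bal (Suc (Suc j)) (m - t) \<le> bal (Suc (Suc j)) (n - t) + bal (Suc (Suc j)) m"
    using bal_convex[of "n - t" "m - t" "Suc (Suc j)" t] assms qn unfolding n_def[symmetric] by simp
  ultimately show ?thesis by linarith
qed

lemma bal_le_power_mult_bal_3: "m \<le> 2 * q \<Longrightarrow> bal (3 + i) m \<le> q ^ i * bal 3 m"
proof (induction i)
  case (Suc i)
  have "m div (4 + i) \<le> m div 2" by (intro div_le_mono2) auto
  then have d: "m div (4 + i) \<le> q" using Suc.prems by linarith
  have "bal (Suc (3 + i)) m \<le> (m div Suc (3 + i)) * bal (3 + i) m" by (rule bal_le_div_mult)
  also have "\<dots> \<le> q * (q ^ i * bal 3 m)" using d Suc by (intro mult_le_mono) auto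
  finally show ?case by (simp add: mult.assoc del: bal.simps(2))
qed simp

text \<open>The case \<open>k = 4\<close> of the major role estimate, and the reason for the
  constant 20: with t = xq it reads (1+x)^3 <= 27x(1-x) in leading order, true at x = 1/20 but false
  at x = 1/25.\<close>

lemma cubic_estimate:
  fixes q t :: nat
  assumes "1 \<le> q" and "t = q div 20 + 1"
  shows "(q + t) ^ 3 \<le> 27 * (t * (q * (q + 1 - t)))"
proof -
  define d where "d = 20 * t - q"
  have d: "20 * t = q + d" using assms unfolding d_def by linarith
  have tq: "t \<le> q" using assms by linarith
  define a :: int where "a = int q"
  define b :: int where "b = int t"
  have ab: "1 \<le> a" "1 \<le> b" "b \<le> a" "a \<le> 20 * b" "b = 1 \<or> 10 * b \<le> a"
    using assms d tq unfolding a_def b_def by linarith+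
  have "(a + b) ^ 3 \<le> 27 * (b * (a * (a + 1 - b)))"
  proof -
    have n1: "0 \<le> a * a * (20 * b - a)" using ab by simp
    show ?thesis
    proof (cases "b = 1")
      case True
      have "0 \<le> (a - 1) * (4 * a + 1)" using ab by simp
      then show ?thesis using n1 unfolding True by (simp add: power3_eq_cube algebra_simps)
    next
      case False
      then have "10 * b \<le> a" using ab by blast
      then have n2: "0 \<le> 4 * (a * b * (a - 10 * b))" "0 \<le> b * b * (a - b)" "0 \<le> a * b" "0 \<le> a * (b * b)" using ab by simp_all
      have "27 * (b * (a * (a + 1 - b))) - (a + b) ^ 3
          = a * a * (20 * b - a) + 4 * (a * b * (a - 10 * b)) + b * b * (a - b) + 27 * (a * b) + 9 * (a * (b * b))"
        by (simp add: power3_eq_cube algebra_simps)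
      then show ?thesis using n1 n2 by linarith
    qed
  qed
  moreover have "int (q + 1 - t) = a + 1 - b" using tq unfolding a_def b_def by simp
  ultimately have "int ((q + t) ^ 3) \<le> int (27 * (t * (q * (q + 1 - t))))"
    unfolding a_def b_def by simp
  then show ?thesis by (simp only: of_nat_le_iff)
qed

text \<open>With \<open>m = S - q\<close> and \<open>q + t = \<nu> + 1\<close>, the left side bounds
  the copies through a vertex whose \<open>S\<close> partners split as \<open>\<nu> + 1\<close>
  against the rest. The smaller product is reduced to three factors, since each further factor is at
  most \<open>q\<close>.\<close>

lemma bal_major_estimate:
  assumes "4 \<le> k" and "1 \<le> q" and "(k - 1) * q \<le> m" and "t = q div 20 + 1"
  shows "bal (k - 1) (q + t) + bal (k - 1) (m - t) \<le> bal (k - 1) m"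
proof -
  define i where "i = k - 4"
  have k: "k - 1 = 3 + i" using assms(1) unfolding i_def by simp
  have tq: "t \<le> q" using assms by linarith
  have "27 * bal 3 (q + t) \<le> 27 * (t * (q * (q + 1 - t)))"
    using bal_3[of "q + t"] cubic_estimate[OF assms(2,4)] by linarith
  then have "bal 3 (q + t) \<le> t * (q * (q + 1 - t))" by simp
  then have "q ^ i * bal 3 (q + t) \<le> q ^ i * (t * (q * (q + 1 - t)))" by (rule mult_le_mono2)
  moreover have "q ^ i * (t * (q * (q + 1 - t))) = t * (q ^ Suc i * (q + 1 - t))" by simp
  moreover have "bal (3 + i) (q + t) \<le> q ^ i * bal 3 (q + t)"
    using tq by (intro bal_le_power_mult_bal_3) simp
  ultimately have "bal (3 + i) (q + t) \<le> t * (q ^ Suc i * (q + 1 - t))" by linarith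
  moreover have i: "3 + i = Suc (Suc (Suc i))" by simp
  moreover have "bal (3 + i) (m - t) + t * (q ^ Suc i * (q + 1 - t)) \<le> bal (3 + i) m"
    unfolding i by (rule bal_decrement[OF tq]) (use assms(3) k i in simp)
  ultimately show ?thesis unfolding k by linarith
qed

text \<open>Reduces \<open>k = 5 + i\<close> to \<open>k = 5\<close>: one more role multiplies the
  left side by at most \<open>q\<close>, because the new factor is at most
  \<open>\<nu> div (5 + i)\<close>, which outweighs the growth of the coefficient.\<close>

lemma bal_wrong_role_estimate:
  "\<nu> \<le> 2 * q \<Longrightarrow> (6 + i) * bal (4 + i) \<nu> \<le> q ^ i * (6 * bal 4 \<nu>)"
proof (induction i)
  case (Suc i)
  define d where "d = \<nu> div (5 + i)"
  have "d * (5 + i) \<le> \<nu>" unfolding d_def by (rule div_times_less_eq_dividend)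
  then have "2 * (d * (5 + i)) \<le> 4 * q" using Suc.prems by linarith
  moreover have "(7 + i) * d \<le> 2 * (d * (5 + i))" by (simp add: algebra_simps)
  moreover have "4 * q \<le> (6 + i) * q" by (simp add: algebra_simps)
  ultimately have d: "(7 + i) * d \<le> (6 + i) * q" by linarith
  have "bal (Suc (4 + i)) \<nu> \<le> d * bal (4 + i) \<nu>"
    using bal_le_div_mult[of "4 + i" \<nu>] unfolding d_def by simp
  then have "(7 + i) * bal (Suc (4 + i)) \<nu> \<le> (7 + i) * d * bal (4 + i) \<nu>"
    by (metis mult.assoc mult_le_mono2)
  also have "\<dots> \<le> (6 + i) * q * bal (4 + i) \<nu>" using d by (rule mult_le_mono1)
  also have "\<dots> = q * ((6 + i) * bal (4 + i) \<nu>)" by (simp only: mult.assoc mult.left_commute)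
  also have "\<dots> \<le> q * (q ^ i * (6 * bal 4 \<nu>))" using Suc by (intro mult_le_mono2)
  finally show ?case by (simp only: add_Suc_right power_Suc mult.assoc) (simp del: bal.simps(2))
qed simp

lemma bal_bad_pair_estimate:
  "m \<le> 2 * q \<Longrightarrow> (5 + i) * (4 + i) * bal (3 + i) m \<le> q ^ i * (20 * bal 3 m)"
proof (induction i)
  case (Suc i)
  define d where "d = m div (4 + i)"
  have "d * (4 + i) \<le> m" unfolding d_def by (rule div_times_less_eq_dividend)
  moreover have "d * 4 \<le> d * (4 + i)" by simp
  ultimately have "2 * d \<le> q" using Suc.prems by linarith
  then have "(4 + i) * (2 * d) \<le> (4 + i) * q" by (rule mult_le_mono2)
  moreover have "(6 + i) * d \<le> (4 + i) * (2 * d)" by (simp add: algebra_simps)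
  ultimately have d: "(6 + i) * d \<le> (4 + i) * q" by linarith
  have "bal (Suc (3 + i)) m \<le> d * bal (3 + i) m"
    using bal_le_div_mult[of "3 + i" m] unfolding d_def by simp
  then have "(5 + i) * ((6 + i) * bal (Suc (3 + i)) m) \<le> (5 + i) * ((6 + i) * (d * bal (3 + i) m))"
    by (intro mult_le_mono2)
  also have "\<dots> = (5 + i) * bal (3 + i) m * ((6 + i) * d)" by (simp only: mult.assoc mult.left_commute mult.commute)
  also have "\<dots> \<le> (5 + i) * bal (3 + i) m * ((4 + i) * q)" using d by (rule mult_le_mono2)
  also have "\<dots> = q * ((5 + i) * (4 + i) * bal (3 + i) m)" by (simp only: mult.assoc mult.left_commute mult.commute)
  also have "\<dots> \<le> q * (q ^ i * (20 * bal 3 m))" using Suc by (intro mult_le_mono2)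
  finally have "(5 + i) * ((6 + i) * bal (Suc (3 + i)) m) \<le> q ^ Suc i * (20 * bal 3 m)"
    by (simp only: power_Suc mult.assoc)
  moreover have "5 + Suc i = 6 + i" "4 + Suc i = 5 + i" "3 + Suc i = Suc (3 + i)" by simp_all
  ultimately show ?case by (simp only: mult.assoc mult.left_commute mult.commute)
qed simp

lemma power_ratio:
  fixes \<nu> q :: nat
  assumes "20 * \<nu> \<le> 21 * q"
  shows "8000 * \<nu> ^ 3 \<le> 9261 * q ^ 3" and "160000 * \<nu> ^ 4 \<le> 194481 * q ^ 4"
proof -
  show "8000 * \<nu> ^ 3 \<le> 9261 * q ^ 3"
    using power_mono[OF assms, of 3] by (simp add: power_mult_distrib)
  show "160000 * \<nu> ^ 4 \<le> 194481 * q ^ 4"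
    using power_mono[OF assms, of 4] by (simp add: power_mult_distrib)
qed

text \<open>Class sizes are at most \<open>2 * \<nu> + 1\<close>, so the first term is
  \<open>q\<close> times the slope bound \<open>X\<close> of the exchange argument; the second is
  the error from wrong roles. The first is at most 4/9 of the right side except when
  \<open>q = 1\<close>, where the second vanishes.\<close>

lemma exchange_estimate:
  assumes k: "4 \<le> k" and q: "1 \<le> q" and \<nu>: "20 * \<nu> \<le> 21 * q"
  shows "q * ((2 * \<nu> - 1) div k + 1) ^ (k - 2) + (k + 1) * bal (k - 1) \<nu> \<le> q ^ (k - 1)"
proof -
  define Y where "Y = (2 * \<nu> - 1) div 4 + 1"
  define i where "i = k - 4"
  have ki: "k - 1 = 3 + i" "k - 2 = 2 + i" "k = 4 + i" using k unfolding i_def by simp_all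
  have Y: "q = 1 \<and> \<nu> \<le> 1 \<and> Y = 1 \<or> 3 * Y \<le> 2 * q"
  proof -
    define y where "y = (2 * \<nu> - 1) div 4"
    have Yy: "Y = y + 1" unfolding Y_def y_def by simp
    have "4 * y \<le> 2 * \<nu> - 1" unfolding y_def by simp
    then have y: "y = 0 \<or> 4 * y + 1 \<le> 2 * \<nu>" by linarith
    show ?thesis
    proof (cases "y = 0")
      case True
      then show ?thesis using q \<nu> unfolding Yy by (cases "q = 1") simp_all
    next
      case False
      then have y': "4 * y + 1 \<le> 2 * \<nu>" using y by simp
      \<comment> \<open>From \<open>q = 6\<close> on, the gap between 63q and 80q absorbs the
        rounding term 90; smaller values need the integrality of \<open>\<nu>\<close> and
        \<open>y\<close>.\<close>
      consider "q = 1" | "q = 2" | "q = 3" | "q = 4" | "q = 5" | "6 \<le> q" using q by linarith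
      then have "3 * (y + 1) \<le> 2 * q"
      proof cases
        case 3
        then have "\<nu> \<le> 3" using \<nu> by linarith
        then have "y \<le> 1" using y' by linarith
        then show ?thesis using 3 by simp
      next
        case 4
        then have "\<nu> \<le> 4" using \<nu> by linarith
        then have "y \<le> 1" using y' by linarith
        then show ?thesis using 4 by simp
      next
        case 5
        then have "\<nu> \<le> 5" using \<nu> by linarith
        then have "y \<le> 2" using y' by linarith
        then show ?thesis using 5 by simp
      next
        case 6
        have "40 * y + 10 \<le> 21 * q" using y' \<nu> by linarith
        then have "120 * (y + 1) \<le> 80 * q" using 6 by simp
        then show ?thesis by simp
      qed (use y' \<nu> False in linarith)+
      then show ?thesis unfolding Yy by simp
    qed
  qed
  then have Yq: "Y \<le> q" by linarith
  have Y2: "q = 1 \<and> \<nu> \<le> 1 \<and> Y = 1 \<or> 9 * Y ^ 2 \<le> 4 * q ^ 2"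
    using Y power_mono[of "3 * Y" "2 * q" 2] by (auto simp: power_mult_distrib)
  have X: "((2 * \<nu> - 1) div k + 1) ^ (k - 2) \<le> q ^ i * Y ^ 2"
  proof -
    have "(2 * \<nu> - 1) div k + 1 \<le> Y" unfolding Y_def using k by (simp add: div_le_mono2)
    then have "((2 * \<nu> - 1) div k + 1) ^ (k - 2) \<le> Y ^ (k - 2)" by (rule power_mono) simp
    also have "\<dots> = Y ^ i * Y ^ 2" by (simp only: ki(2) power_add mult.commute)
    also have "\<dots> \<le> q ^ i * Y ^ 2" using Yq by (intro mult_le_mono1 power_mono) auto
    finally show ?thesis .
  qed
  show ?thesis
  proof (cases "i = 0")
    case True
    have "q * Y ^ 2 + 5 * bal 3 \<nu> \<le> q ^ 3"
      using Y2
    proof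
      assume "q = 1 \<and> \<nu> \<le> 1 \<and> Y = 1"
      then show ?thesis using bal_eq_0[of \<nu> 3] by simp
    next
      assume "9 * Y ^ 2 \<le> 4 * q ^ 2"
      then have "q * (9 * Y ^ 2) \<le> q * (4 * q ^ 2)" by (rule mult_le_mono2)
      then have "9 * (q * Y ^ 2) \<le> 4 * q ^ 3" by (simp add: power2_eq_square power3_eq_cube)
      then show ?thesis using bal_3[of \<nu>] power_ratio(1)[OF \<nu>] by linarith
    qed
    moreover have "q * ((2 * \<nu> - 1) div k + 1) ^ (k - 2) \<le> q * Y ^ 2"
      using X True by (intro mult_le_mono2) simp
    moreover have "k - 1 = 3" "k + 1 = 5" using True ki by simp_all
    ultimately show ?thesis by presburger
  next
    case False
    then obtain i' where i': "i = Suc i'" by (cases i) auto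
    have "q * (q * Y ^ 2) + 6 * bal 4 \<nu> \<le> q ^ 4"
      using Y2
    proof
      assume "q = 1 \<and> \<nu> \<le> 1 \<and> Y = 1"
      then show ?thesis using bal_eq_0[of \<nu> 4] by simp
    next
      assume "9 * Y ^ 2 \<le> 4 * q ^ 2"
      then have "q * q * (9 * Y ^ 2) \<le> q * q * (4 * q ^ 2)" by (rule mult_le_mono2)
      then have "9 * (q * (q * Y ^ 2)) \<le> 4 * q ^ 4" by (simp add: power2_eq_square power4_eq_xxxx)
      then show ?thesis using bal_4[of \<nu>] power_ratio(2)[OF \<nu>] by linarith
    qed
    then have "q ^ i' * (q * (q * Y ^ 2) + 6 * bal 4 \<nu>) \<le> q ^ i' * q ^ 4" by (rule mult_le_mono2)
    then have "q * (q ^ i * Y ^ 2) + q ^ i' * (6 * bal 4 \<nu>) \<le> q ^ (k - 1)"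
      unfolding ki i' by (simp add: distrib_left power_add mult.left_commute mult.commute mult.assoc numeral_eq_Suc del: bal.simps(2))
    moreover have "(k + 1) * bal (k - 1) \<nu> \<le> q ^ i' * (6 * bal 4 \<nu>)"
    proof -
      have "k + 1 = 6 + i'" "k - 1 = 4 + i'" unfolding ki i' by simp_all
      then show ?thesis using bal_wrong_role_estimate[of \<nu> q i'] \<nu> by simp
    qed
    moreover have "q * ((2 * \<nu> - 1) div k + 1) ^ (k - 2) \<le> q * (q ^ i * Y ^ 2)"
      using X by (rule mult_le_mono2)
    ultimately show ?thesis by linarith
  qed
qed

text \<open>Numerical input for the union bound over pairs of roles, with
  \<open>2 * \<nu> + 1\<close> as class bound. For large \<open>q\<close> and \<open>k = 5\<close>
  the left side is below half of the right, whereas for \<open>k = 4\<close> the analogous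
  inequality is false.\<close>

lemma bad_pair_estimate_ge_5:
  assumes k: "5 \<le> k" and q: "1 \<le> q" and \<nu>: "20 * \<nu> \<le> 21 * q" "1 \<le> \<nu>"
  shows "k * (k - 1) * bal (k - 2) (\<nu> - 1) * (2 * \<nu> + 1) + 4 * ((k + 1) * bal (k - 1) \<nu>) \<le> 4 * q ^ (k - 1)"
proof -
  define i where "i = k - 5"
  have ki: "k = 5 + i" "k - 1 = 4 + i" "k - 2 = 3 + i" "k + 1 = 6 + i" using k unfolding i_def by simp_all
  define m where "m = \<nu> - 1"
  have m: "\<nu> = m + 1" using \<nu>(2) unfolding m_def by simp
  have "27 * (bal 3 m * (2 * \<nu> + 1)) \<le> m ^ 3 * (2 * \<nu> + 1)" using mult_le_mono1[OF bal_3[of m], of "2 * \<nu> + 1"] by (simp del: bal.simps(2))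
  also have "\<dots> \<le> 2 * \<nu> ^ 4" unfolding m by (simp add: power3_eq_cube power4_eq_xxxx algebra_simps)
  finally have "20 * (bal 3 m * (2 * \<nu> + 1)) + 24 * bal 4 \<nu> \<le> 4 * q ^ 4"
    using bal_4[of \<nu>] power_ratio(2)[OF \<nu>(1)] by linarith
  then have "q ^ i * (20 * (bal 3 m * (2 * \<nu> + 1)) + 24 * bal 4 \<nu>) \<le> q ^ i * (4 * q ^ 4)" by (rule mult_le_mono2)
  then have main: "q ^ i * (20 * bal 3 m) * (2 * \<nu> + 1) + 4 * (q ^ i * (6 * bal 4 \<nu>)) \<le> 4 * q ^ (4 + i)"
    by (simp add: distrib_left power_add mult.left_commute mult.commute mult.assoc del: bal.simps(2))
  have "(5 + i) * (4 + i) * bal (3 + i) m * (2 * \<nu> + 1) \<le> q ^ i * (20 * bal 3 m) * (2 * \<nu> + 1)"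
    using \<nu> by (intro mult_le_mono1 bal_bad_pair_estimate) (simp add: m_def)
  moreover have "(6 + i) * bal (4 + i) \<nu> \<le> q ^ i * (6 * bal 4 \<nu>)"
    using \<nu> by (intro bal_wrong_role_estimate) simp
  ultimately show ?thesis using main unfolding ki(2-4) unfolding ki(1) m_def by linarith
qed

text \<open>Used in contrapositive form: a class of more than \<open>q + u\<close> vertices leaves
  too few transversals. Since \<open>u\<close> is at least q/4, the coefficients add up to (11/12)^3
  + (5/27) 1.05^3, about 0.985, so there is little room.\<close>

lemma class_size_estimate_4:
  assumes q: "1 \<le> q" and \<nu>: "20 * \<nu> \<le> 21 * q" and m: "3 * q \<le> m" and u: "u = (q + 3) div 4"
  shows "bal 3 (m - u) + 5 * bal 3 \<nu> \<le> bal 3 m"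
proof -
  have uq: "u \<le> q" "q \<le> 4 * u" using q u by linarith+
  have "(4 * (3 * q - u)) ^ 3 \<le> (11 * q) ^ 3" using uq by (intro power_mono) auto
  then have "64 * (3 * q - u) ^ 3 \<le> 1331 * q ^ 3" by (simp add: power_mult_distrib)
  moreover have "q ^ 3 \<le> bal 3 (3 * q)" by (rule bal_ge) simp
  ultimately have "bal 3 (3 * q - u) + 5 * bal 3 \<nu> \<le> bal 3 (3 * q)"
    using bal_3[of "3 * q - u"] bal_3[of \<nu>] power_ratio(1)[OF \<nu>] by linarith
  moreover have "bal 3 (3 * q) + bal 3 (m - u) \<le> bal 3 (3 * q - u) + bal 3 m"
    using bal_convex[of "3 * q - u" "m - u" 3 u] uq m by simp
  ultimately show ?thesis by linarith
qed

lemma bad_pair_estimate_4: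
  assumes q: "1 \<le> q" and \<nu>: "20 * \<nu> \<le> 21 * q" "1 \<le> \<nu>" and u: "u = (q + 3) div 4"
  shows "2 * bal 2 (\<nu> - 1) * (q + u) + 5 * bal 3 \<nu> \<le> q ^ 3"
proof -
  define m where "m = \<nu> - 1"
  have m: "20 * m + 20 \<le> 21 * q" using \<nu> unfolding m_def by linarith
  have qu: "4 * (q + u) \<le> 5 * q + 3"
  proof -
    have "4 * u \<le> q + 3" by (simp add: u)
    then show ?thesis by simp
  qed
  \<comment> \<open>The \<open>- 1\<close> in \<open>\<nu> - 1\<close> supplies the
    \<open>+ 20\<close>, which pays for the \<open>+ 3\<close> from rounding \<open>u\<close>
    up.\<close>
  have "(20 * m + 20) * (5 * q + 3) \<le> 21 * q * (5 * q + 3)" using m by (rule mult_le_mono1)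
  then have "20 * (m * (5 * q + 3)) \<le> 105 * q ^ 2" by (simp add: algebra_simps power2_eq_square)
  moreover have "20 * m \<le> 21 * q" using m by simp
  ultimately have "20 * m * (20 * (m * (5 * q + 3))) \<le> 21 * q * (105 * q ^ 2)" by (rule mult_le_mono[rotated])
  then have a: "400 * (m ^ 2 * (5 * q + 3)) \<le> 2205 * q ^ 3"
    by (simp add: power2_eq_square power3_eq_cube mult.assoc mult.left_commute)
  have "4 * bal 2 m * (4 * (q + u)) \<le> m ^ 2 * (5 * q + 3)" using qu bal_2[of m] by (rule mult_le_mono[rotated])
  then have "16 * (bal 2 m * (q + u)) \<le> m ^ 2 * (5 * q + 3)" by (simp add: algebra_simps)
  then have "2 * (bal 2 m * (q + u)) + 5 * bal 3 \<nu> \<le> q ^ 3"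
    using a bal_3[of \<nu>] power_ratio(1)[OF \<nu>(1)] by linarith
  then show ?thesis unfolding m_def by (simp only: mult.assoc)
qed

text \<open>Ensures that for four roles at most half of the transversals are lost, as the
  inclusion-exclusion argument requires.\<close>

lemma wrong_role_estimate_4: "20 * \<nu> \<le> 21 * q \<Longrightarrow> 10 * bal 3 \<nu> \<le> q ^ 3"
  using bal_3[of \<nu>] power_ratio(1)[of \<nu> q] by linarith

section \<open>Copies as role assignments\<close>

text \<open>An edge of the host graph with a given colour and orientation can play the part of exactly one
  edge of \<open>R\<close>, so it determines the role \<open>lab x y\<close> of \<open>x\<close> and the role \<open>lab y x\<close> of \<open>y\<close> in every
  copy containing both. A copy is then an assignment of vertices to roles compatible with \<open>lab\<close>.\<close>

definition copies :: "'b set \<Rightarrow> ('a \<Rightarrow> 'a \<Rightarrow> 'b) \<Rightarrow> 'a set \<Rightarrow> ('b \<Rightarrow> 'a) set" where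
  "copies W lab V = {g \<in> W \<rightarrow>\<^sub>E V. \<forall>i\<in>W. \<forall>j\<in>W. i \<noteq> j \<longrightarrow> g i \<noteq> g j \<and> lab (g i) (g j) = i}"

lemma copiesD:
  assumes "g \<in> copies W lab V"
  shows "g \<in> W \<rightarrow>\<^sub>E V" and "i \<in> W \<Longrightarrow> g i \<in> V"
    and "i \<in> W \<Longrightarrow> j \<in> W \<Longrightarrow> i \<noteq> j \<Longrightarrow> g i \<noteq> g j"
    and "i \<in> W \<Longrightarrow> j \<in> W \<Longrightarrow> i \<noteq> j \<Longrightarrow> lab (g i) (g j) = i"
  using assms unfolding copies_def by auto

lemma finite_copies: "finite W \<Longrightarrow> finite V \<Longrightarrow> finite (copies W lab V)"
  unfolding copies_def by (intro finite_subset[OF _ finite_PiE]) auto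

text \<open>A single role with more than \<open>\<nu>\<close> partners splits off alone. Otherwise a
  minimal set of roles reaching \<open>\<nu> + 1\<close> has sum at most \<open>2 * \<nu>\<close>,
  leaving more than \<open>\<nu>\<close> outside.\<close>

lemma exists_role_split:
  fixes n :: "'b \<Rightarrow> nat"
  assumes "finite W" and "sum n W = S" and "3 * \<nu> + 1 \<le> S"
    and small: "\<And>i. i \<in> W \<Longrightarrow> n i + \<nu> < S"
  shows "\<exists>A\<subseteq>W. \<nu> + 1 \<le> sum n A \<and> sum n A + \<nu> + 1 \<le> S"
proof (cases "\<exists>i\<in>W. \<nu> + 1 \<le> n i")
  case True
  then obtain i where "i \<in> W" "\<nu> + 1 \<le> n i" by blast
  then show ?thesis using small[of i] by (intro exI[of _ "{i}"]) auto
next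
  case False
  define Q where "Q A \<longleftrightarrow> A \<subseteq> W \<and> \<nu> + 1 \<le> sum n A" for A
  have "Q W" using assms unfolding Q_def by simp
  then obtain A where A: "Q A" "\<And>B. Q B \<Longrightarrow> card A \<le> card B"
    using ex_has_least_nat[of Q W card] by blast
  have fA: "finite A" using A(1) assms(1) unfolding Q_def by (auto intro: finite_subset)
  have "A \<noteq> {}" using A(1) unfolding Q_def by auto
  then obtain a where a: "a \<in> A" by blast
  have "\<not> Q (A - {a})" using A(2)[of "A - {a}"] card_Diff1_less[OF fA a] by linarith
  then have "sum n (A - {a}) \<le> \<nu>" using A(1) unfolding Q_def by auto
  moreover have "n a \<le> \<nu>"
  proof -
    have "a \<in> W" using a A(1) unfolding Q_def by blast
    then have "\<not> \<nu> + 1 \<le> n a" using False by blast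
    then show ?thesis by simp
  qed
  ultimately have "sum n A \<le> 2 * \<nu>" using sum.remove[OF fA a, of n] by simp
  then show ?thesis using A(1) assms(3) unfolding Q_def by (intro exI[of _ A]) auto
qed

text \<open>Without a major role the partners split into two groups of more than
  \<open>\<nu>\<close> each. Superadditivity merges the roles within each group, convexity moves the
  split to its extreme position, and \<open>bal_major_estimate\<close> contradicts
  \<open>big\<close>.\<close>

lemma exists_major_role:
  fixes n :: "'b \<Rightarrow> nat"
  assumes W: "finite W" "card W = k" "4 \<le> k" and S: "sum n W = S" and q: "q = S div k" "1 \<le> q"
    and big: "bal (k - 1) (S - q) < (\<Sum>i\<in>W. bal (k - 1) (n i))"
  shows "\<exists>i\<in>W. S \<le> n i + (q + q div 20)"
proof (rule ccontr)
  assume neg: "\<not> ?thesis"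
  define \<nu> where "\<nu> = q + q div 20"
  have kq: "k * q \<le> S" unfolding q by simp
  moreover have "4 * q \<le> k * q" using W by (intro mult_le_mono1)
  ultimately have q4: "4 * q \<le> S" by linarith
  have k0: "0 < k - 1" using W by simp
  have "3 * \<nu> + 1 \<le> 4 * q"
  proof -
    define d where "d = q div 20"
    have "d * 20 \<le> q" unfolding d_def by (rule div_times_less_eq_dividend)
    then have "3 * d + 1 \<le> q" using q(2) by (cases "d = 0") auto
    then show ?thesis unfolding \<nu>_def d_def by simp
  qed
  then have \<nu>S: "3 * \<nu> + 1 \<le> S" using q4 by linarith
  have "\<exists>A\<subseteq>W. \<nu> + 1 \<le> sum n A \<and> sum n A + \<nu> + 1 \<le> S"
    using neg by (intro exists_role_split[OF W(1) S \<nu>S]) (auto simp: \<nu>_def not_le)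
  then obtain A where A: "A \<subseteq> W" "\<nu> + 1 \<le> sum n A" "sum n A + \<nu> + 1 \<le> S" by blast
  define a where "a = sum n A"
  have fA: "finite A" using A(1) W(1) by (rule finite_subset)
  have Sa: "sum n (W - A) = S - a" using sum.subset_diff[OF A(1) W(1), of n] S unfolding a_def by simp
  have "(\<Sum>i\<in>W. bal (k - 1) (n i)) = (\<Sum>i\<in>W - A. bal (k - 1) (n i)) + (\<Sum>i\<in>A. bal (k - 1) (n i))"
    by (rule sum.subset_diff[OF A(1) W(1)])
  also have "\<dots> \<le> bal (k - 1) (S - a) + bal (k - 1) a"
    using bal_sum_le[of "W - A" "k - 1" n] bal_sum_le[of A "k - 1" n] W(1) fA k0
    unfolding Sa a_def by simp
  also have "\<dots> \<le> bal (k - 1) (\<nu> + 1) + bal (k - 1) (S - \<nu> - 1)"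
  proof -
    have e: "(\<nu> + 1) + (a - \<nu> - 1) = a" "(S - a) + (a - \<nu> - 1) = S - \<nu> - 1" "\<nu> + 1 \<le> S - a"
      using A unfolding a_def by linarith+
    show ?thesis using bal_convex[OF e(3), of "k - 1" "a - \<nu> - 1"] unfolding e(1,2) by linarith
  qed
  also have "\<dots> \<le> bal (k - 1) (S - q)"
  proof -
    have "(k - 1) * q \<le> S - q" using kq by (simp add: diff_mult_distrib)
    then have "bal (k - 1) (q + (q div 20 + 1)) + bal (k - 1) (S - q - (q div 20 + 1)) \<le> bal (k - 1) (S - q)"
      by (rule bal_major_estimate[OF W(3) q(2)]) simp
    then show ?thesis unfolding \<nu>_def by (simp add: add.assoc)
  qed
  finally show False using big by simp
qed

section \<open>Counting copies with prescribed roles\<close>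

locale role_labelling =
  fixes W :: "'b set" and V :: "'a set" and lab :: "'a \<Rightarrow> 'a \<Rightarrow> 'b"
  assumes finite_W: "finite W" and finite_V: "finite V"
    and lab_in: "x \<in> V \<Longrightarrow> y \<in> V \<Longrightarrow> x \<noteq> y \<Longrightarrow> lab x y \<in> W"
    and lab_neq: "x \<in> V \<Longrightarrow> y \<in> V \<Longrightarrow> x \<noteq> y \<Longrightarrow> lab x y \<noteq> lab y x"
begin

abbreviation "C \<equiv> copies W lab V"

definition nb :: "'b \<Rightarrow> 'a \<Rightarrow> 'a set" where
  "nb i x = {y \<in> V. y \<noteq> x \<and> lab x y = i}"

lemma finite_nb [simp]: "finite (nb i x)"
  using finite_V unfolding nb_def by simp

lemma finite_C [simp]: "finite C"
  using finite_copies finite_W finite_V by blast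

text \<open>Once \<open>f i\<close> has role \<open>i\<close>, a vertex playing \<open>j\<close>
  must give the edge to \<open>f i\<close> the roles \<open>i\<close> and \<open>j\<close>. The
  candidates for different \<open>j\<close> are thus disjoint subsets of \<open>nb i (f i)\<close>,
  and the product of their sizes is at most the balanced one.\<close>

lemma card_copies_extending:
  assumes "I \<subseteq> W" and "i \<in> I"
  shows "card {g \<in> C. \<forall>j\<in>I. g j = f j} \<le> bal (card (W - I)) (card (nb i (f i) - f ` I))"
proof -
  define A where "A j = {z \<in> nb i (f i) - f ` I. lab z (f i) = j}" for j
  define G where "G = {g \<in> C. \<forall>j\<in>I. g j = f j}"
  have fA: "finite (A j)" for j unfolding A_def by simp
  have inj: "inj_on (\<lambda>g. restrict g (W - I)) G"
  proof (rule inj_onI)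
    fix g h assume g: "g \<in> G" and h: "h \<in> G" and eq: "restrict g (W - I) = restrict h (W - I)"
    have PE: "g \<in> W \<rightarrow>\<^sub>E V" "h \<in> W \<rightarrow>\<^sub>E V"
      using g h copiesD(1)[of g W lab V] copiesD(1)[of h W lab V] unfolding G_def by simp_all
    show "g = h"
    proof (rule PiE_ext[OF PE])
      fix j assume "j \<in> W"
      show "g j = h j"
      proof (cases "j \<in> I")
        case True
        then show ?thesis using g h unfolding G_def by simp
      next
        case False
        then show ?thesis using fun_cong[OF eq, of j] \<open>j \<in> W\<close> by simp
      qed
    qed
  qed
  have img: "(\<lambda>g. restrict g (W - I)) ` G \<subseteq> (\<Pi>\<^sub>E j\<in>W - I. A j)"
  proof (rule image_subsetI, rule restrict_PiE_iff[THEN iffD2], rule ballI)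
    fix g j assume g: "g \<in> G" and j: "j \<in> W - I"
    have C: "g \<in> C" and ag: "\<And>l. l \<in> I \<Longrightarrow> g l = f l" using g unfolding G_def by auto
    have gi: "f i = g i" using ag assms by simp
    have ij: "i \<in> W" "j \<in> W" "i \<noteq> j" using assms j by auto
    have "g j \<notin> f ` I"
    proof
      assume "g j \<in> f ` I"
      then obtain l where "l \<in> I" "g j = f l" by blast
      then show False using copiesD(3)[OF C, of j l] ag j assms by auto
    qed
    then show "g j \<in> A j"
      using copiesD(2)[OF C ij(2)] copiesD(3)[OF C ij] copiesD(4)[OF C ij] copiesD(4)[OF C ij(2,1)] ij(3)
      unfolding A_def nb_def gi by auto
  qed
  have "card G \<le> card (\<Pi>\<^sub>E j\<in>W - I. A j)"
    using card_inj_on_le[OF inj img] finite_W fA by (simp add: finite_PiE)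
  also have "\<dots> = (\<Prod>j\<in>W - I. card (A j))" using finite_W by (simp add: card_PiE)
  also have "\<dots> \<le> bal (card (W - I)) (\<Sum>j\<in>W - I. card (A j))" using finite_W by (intro prod_le_bal) simp
  also have "\<dots> \<le> bal (card (W - I)) (card (nb i (f i) - f ` I))"
  proof (rule bal_mono)
    have "(\<Sum>j\<in>W - I. card (A j)) = card (\<Union>j\<in>W - I. A j)"
      using finite_W fA by (intro card_UN_disjoint[symmetric]) (auto simp: A_def)
    also have "\<dots> \<le> card (nb i (f i) - f ` I)" by (intro card_mono) (auto simp: A_def)
    finally show "(\<Sum>j\<in>W - I. card (A j)) \<le> card (nb i (f i) - f ` I)" .
  qed
  finally show ?thesis unfolding G_def .
qed

lemma card_copies_role:
  assumes "i \<in> W"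
  shows "card {g \<in> C. g i = x} \<le> bal (card W - 1) (card (nb i x))"
proof -
  have "card {g \<in> C. \<forall>j\<in>{i}. g j = x} \<le> bal (card (W - {i})) (card (nb i x - (\<lambda>_. x) ` {i}))"
    using assms by (intro card_copies_extending[of "{i}" i "\<lambda>_. x"]) auto
  also have "\<dots> \<le> bal (card W - 1) (card (nb i x))"
    using assms finite_W by (simp add: bal_mono card_mono)
  finally show ?thesis by simp
qed

lemma sum_card_nb:
  assumes "x \<in> V"
  shows "(\<Sum>i\<in>W. card (nb i x)) = card V - 1"
proof -
  have "(\<Sum>i\<in>W. card (nb i x)) = card (\<Union>i\<in>W. nb i x)"
    using finite_W finite_V by (intro card_UN_disjoint[symmetric]) (auto simp: nb_def)
  also have "(\<Union>i\<in>W. nb i x) = V - {x}" using lab_in assms by (auto simp: nb_def)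
  finally show ?thesis using assms finite_V by simp
qed

lemma card_copies_containing:
  "card {g \<in> C. x \<in> g ` W} \<le> (\<Sum>i\<in>W. bal (card W - 1) (card (nb i x)))"
proof -
  have "{g \<in> C. x \<in> g ` W} \<subseteq> (\<Union>i\<in>W. {g \<in> C. g i = x})" by auto
  then have "card {g \<in> C. x \<in> g ` W} \<le> card (\<Union>i\<in>W. {g \<in> C. g i = x})"
    using finite_W by (intro card_mono) auto
  also have "\<dots> \<le> (\<Sum>i\<in>W. card {g \<in> C. g i = x})" using finite_W by (rule card_UN_le)
  also have "\<dots> \<le> (\<Sum>i\<in>W. bal (card W - 1) (card (nb i x)))" by (intro sum_mono card_copies_role)
  finally show ?thesis .
qed

end

lemma card_ge_2_obtain:
  assumes "2 \<le> card A"
  obtains a b where "a \<in> A" "b \<in> A" "a \<noteq> b"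
proof -
  have fin: "finite A" using assms card.infinite by fastforce
  have "A \<noteq> {}" using assms by auto
  then obtain a where a: "a \<in> A" by blast
  have "card (A - {a}) \<noteq> 0" using assms a fin by simp
  then have "A - {a} \<noteq> {}" by (metis card.empty)
  then obtain b where "b \<in> A - {a}" by blast
  then show ?thesis using a that by blast
qed

text \<open>Conditions on \<open>P\<close> and on its complement are independent. This yields both
  the number of transversals through a bad pair and the product rule for two complementary bad
  pairs.\<close>

lemma card_PiE_restrict:
  assumes P: "P \<subseteq> W" and A: "A \<subseteq> Pi\<^sub>E P S" and B: "B \<subseteq> Pi\<^sub>E (W - P) S"
  shows "card {g \<in> Pi\<^sub>E W S. restrict g P \<in> A \<and> restrict g (W - P) \<in> B} = card A * card B"
proof -
  let ?G = "{g \<in> Pi\<^sub>E W S. restrict g P \<in> A \<and> restrict g (W - P) \<in> B}"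
  let ?join = "\<lambda>(f, h) i. if i \<in> P then f i else h i"
  have "bij_betw (\<lambda>g. (restrict g P, restrict g (W - P))) ?G (A \<times> B)"
  proof (rule bij_betw_byWitness[where f' = ?join])
    show "\<forall>g\<in>?G. ?join (restrict g P, restrict g (W - P)) = g"
    proof
      fix g assume "g \<in> ?G"
      then have mem: "g \<in> Pi\<^sub>E W S" by blast
      show "?join (restrict g P, restrict g (W - P)) = g"
      proof
        fix i
        show "?join (restrict g P, restrict g (W - P)) i = g i"
          using PiE_arb[OF mem, of i] P by (cases "i \<in> W") auto
      qed
    qed
    have rP: "restrict (?join fh) P = fst fh" if "fh \<in> A \<times> B" for fh
    proof -
      have mem: "fst fh \<in> Pi\<^sub>E P S" using subsetD[OF A, of "fst fh"] that by auto
      show ?thesis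
      proof
        fix i
        show "restrict (?join fh) P i = fst fh i"
          using PiE_arb[OF mem, of i] by (cases "i \<in> P") (simp_all add: case_prod_beta)
      qed
    qed
    have rQ: "restrict (?join fh) (W - P) = snd fh" if "fh \<in> A \<times> B" for fh
    proof -
      have mem: "snd fh \<in> Pi\<^sub>E (W - P) S" using subsetD[OF B, of "snd fh"] that by auto
      show ?thesis
      proof
        fix i
        show "restrict (?join fh) (W - P) i = snd fh i"
          using PiE_arb[OF mem, of i] by (cases "i \<in> W - P") (simp_all add: case_prod_beta)
      qed
    qed
    show "\<forall>fh\<in>A \<times> B. (restrict (?join fh) P, restrict (?join fh) (W - P)) = fh"
    proof
      fix fh assume fh: "fh \<in> A \<times> B"
      show "(restrict (?join fh) P, restrict (?join fh) (W - P)) = fh"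
        unfolding rP[OF fh] rQ[OF fh] by simp
    qed
    show "(\<lambda>g. (restrict g P, restrict g (W - P))) ` ?G \<subseteq> A \<times> B" by auto
    show "?join ` (A \<times> B) \<subseteq> ?G"
    proof (rule image_subsetI)
      fix fh assume fh: "fh \<in> A \<times> B"
      have f: "fst fh \<in> Pi\<^sub>E P S" and h: "snd fh \<in> Pi\<^sub>E (W - P) S"
        using subsetD[OF A, of "fst fh"] subsetD[OF B, of "snd fh"] fh by auto
      have "?join fh \<in> Pi\<^sub>E W S"
      proof (rule PiE_I)
        fix i assume "i \<in> W"
        then show "?join fh i \<in> S i" using f h by (cases "i \<in> P") (simp_all add: case_prod_beta PiE_mem)
      next
        fix i assume "i \<notin> W"
        then show "?join fh i = undefined" using PiE_arb[OF h, of i] P by (auto simp: case_prod_beta)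
      qed
      moreover have "restrict (?join fh) P \<in> A" "restrict (?join fh) (W - P) \<in> B"
        unfolding rP[OF fh] rQ[OF fh] using fh by auto
      ultimately show "?join fh \<in> ?G" by blast
    qed
  qed
  then show ?thesis by (simp add: bij_betw_same_card card_cartesian_product)
qed

section \<open>Classes by major role and bad edges\<close>

locale major_roles = role_labelling W V lab
  for W :: "'b set" and V :: "'a set" and lab :: "'a \<Rightarrow> 'a \<Rightarrow> 'b" +
  fixes r :: "'a \<Rightarrow> 'b" and \<nu> :: nat
  assumes r_in: "x \<in> V \<Longrightarrow> r x \<in> W"
    and r_major: "x \<in> V \<Longrightarrow> card V - 1 \<le> card (nb (r x) x) + \<nu>"
    and card_W: "4 \<le> card W"
begin

definition bad :: "'a \<Rightarrow> 'a set" where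
  "bad x = {y \<in> V. y \<noteq> x \<and> lab x y \<noteq> r x}"

definition cls :: "'b \<Rightarrow> 'a set" where
  "cls i = {x \<in> V. r x = i}"

definition correct :: "('b \<Rightarrow> 'a) set" where
  "correct = {g \<in> C. \<forall>i\<in>W. r (g i) = i}"

definition inner :: "('b \<Rightarrow> 'a) set" where
  "inner = {g \<in> C. \<exists>c\<in>W. \<forall>i\<in>W. r (g i) = c}"

definition crossing :: "('b \<Rightarrow> 'a) set" where
  "crossing = C - correct - inner"

definition missing :: "('b \<Rightarrow> 'a) set" where
  "missing = Pi\<^sub>E W cls - C"

text \<open>Badness at one end suffices. Edges inside a class are excluded because each of them has
  a wrong role at one end anyway.\<close>

definition bad_edges :: "'a set set" where
  "bad_edges = {e. \<exists>x\<in>V. \<exists>y\<in>V. e = {x, y} \<and> r x \<noteq> r y \<and> y \<in> bad x}"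

lemma finite_bad [simp]: "finite (bad x)" and finite_cls [simp]: "finite (cls i)"
  using finite_V unfolding bad_def cls_def by simp_all

lemma cls_subset: "cls i \<subseteq> V"
  unfolding cls_def by blast

lemma finite_transversals [simp]: "P \<subseteq> W \<Longrightarrow> finite (Pi\<^sub>E P cls)"
  using finite_subset[OF _ finite_W, of P] by (intro finite_PiE) simp_all

lemma finite_missing [simp]: "finite missing"
  unfolding missing_def by simp

lemma finite_bad_edges [simp]: "finite bad_edges"
proof (rule finite_subset)
  show "bad_edges \<subseteq> Pow V" unfolding bad_edges_def by auto
qed (simp add: finite_V)

lemma card_bad:
  assumes "x \<in> V"
  shows "card (bad x) \<le> \<nu>"
proof -
  have "bad x = V - {x} - nb (r x) x" unfolding bad_def nb_def by auto
  moreover have "nb (r x) x \<subseteq> V - {x}" unfolding nb_def by auto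
  ultimately have "card (bad x) = card V - 1 - card (nb (r x) x)"
    using assms finite_V by (simp add: card_Diff_subset)
  then show ?thesis using r_major[OF assms] by simp
qed

lemma nb_subset_bad: "i \<noteq> r x \<Longrightarrow> nb i x \<subseteq> bad x"
  unfolding nb_def bad_def by auto

text \<open>All partners of \<open>x\<close> in the roles other than \<open>r x\<close> together
  number at most \<open>\<nu>\<close>, so superadditivity allows one balanced product in place of a
  sum over roles.\<close>

lemma card_copies_wrong_role:
  assumes "x \<in> V"
  shows "card {g \<in> C. \<exists>i\<in>W. g i = x \<and> i \<noteq> r x} \<le> bal (card W - 1) \<nu>"
proof -
  let ?W = "W - {r x}"
  have "{g \<in> C. \<exists>i\<in>W. g i = x \<and> i \<noteq> r x} \<subseteq> (\<Union>i\<in>?W. {g \<in> C. g i = x})" by auto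
  then have "card {g \<in> C. \<exists>i\<in>W. g i = x \<and> i \<noteq> r x} \<le> card (\<Union>i\<in>?W. {g \<in> C. g i = x})"
    using finite_W by (intro card_mono) auto
  also have "\<dots> \<le> (\<Sum>i\<in>?W. card {g \<in> C. g i = x})" using finite_W by (intro card_UN_le) simp
  also have "\<dots> \<le> (\<Sum>i\<in>?W. bal (card W - 1) (card (nb i x)))" by (intro sum_mono card_copies_role) simp
  also have "\<dots> \<le> bal (card W - 1) (\<Sum>i\<in>?W. card (nb i x))"
    using finite_W card_W by (intro bal_sum_le) auto
  also have "\<dots> \<le> bal (card W - 1) \<nu>"
  proof (rule bal_mono)
    have "(\<Sum>i\<in>?W. card (nb i x)) = card (\<Union>i\<in>?W. nb i x)"
      using finite_W finite_V by (intro card_UN_disjoint[symmetric]) (auto simp: nb_def)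
    also have "\<dots> \<le> card (bad x)" using nb_subset_bad by (intro card_mono) auto
    finally show "(\<Sum>i\<in>?W. card (nb i x)) \<le> \<nu>" using card_bad[OF assms] by simp
  qed
  finally show ?thesis .
qed

text \<open>Two vertices of one class cannot both play the class role towards each other, so each
  ordered pair is bad in one direction or the other: v(v - 1) <= 2v\<open>\<nu>\<close>.\<close>

lemma card_cls: "card (cls i) \<le> 2 * \<nu> + 1"
proof -
  define v where "v = card (cls i)"
  define A where "A = (SIGMA x:cls i. cls i - {x})"
  define B where "B = (SIGMA x:cls i. bad x)"
  have "A \<subseteq> B \<union> B\<inverse>"
  proof
    fix z assume "z \<in> A"
    then obtain x y where z: "z = (x, y)" "x \<in> cls i" "y \<in> cls i" "x \<noteq> y" unfolding A_def by auto
    then have "lab x y \<noteq> lab y x" by (intro lab_neq) (auto simp: cls_def)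
    then show "z \<in> B \<union> B\<inverse>" using z unfolding B_def bad_def cls_def by auto
  qed
  moreover have fB: "finite B" unfolding B_def by simp
  ultimately have "card A \<le> card (B \<union> B\<inverse>)" by (intro card_mono) auto
  also have "\<dots> \<le> card B + card (B\<inverse>)" by (rule card_Un_le)
  also have "card (B\<inverse>) = card B" by (rule card_inverse)
  also have "card B \<le> v * \<nu>"
  proof -
    have "card B = (\<Sum>x\<in>cls i. card (bad x))" unfolding B_def by (simp add: card_SigmaI)
    also have "\<dots> \<le> v * \<nu>" unfolding v_def
      using sum_bounded_above[of "cls i" "\<lambda>x. card (bad x)" \<nu>] card_bad cls_subset by auto
    finally show ?thesis .
  qed
  finally have A: "card A \<le> v * \<nu> + v * \<nu>" by simp
  have "card A = (\<Sum>x\<in>cls i. card (cls i - {x}))" unfolding A_def by (simp add: card_SigmaI)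
  also have "\<dots> = (\<Sum>x\<in>cls i. v - 1)" unfolding v_def by (intro sum.cong) auto
  finally have "card A = v * (v - 1)" by (simp add: v_def)
  moreover have "v * (2 * \<nu>) = v * \<nu> + v * \<nu>" by simp
  ultimately have le: "v * (v - 1) \<le> v * (2 * \<nu>)" using A by linarith
  have "v = 0 \<or> v - 1 \<le> 2 * \<nu>" using le mult_le_cancel1[of v "v - 1" "2 * \<nu>"] by blast
  then show ?thesis unfolding v_def[symmetric] by (cases "v = 0") auto
qed

lemma sum_card_cls: "(\<Sum>i\<in>W. card (cls i)) = card V"
proof -
  have "(\<Sum>i\<in>W. card (cls i)) = card (\<Union>i\<in>W. cls i)"
    using finite_W finite_V by (intro card_UN_disjoint[symmetric]) (auto simp: cls_def)
  also have "(\<Union>i\<in>W. cls i) = V" using r_in by (auto simp: cls_def)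
  finally show ?thesis .
qed

lemma card_not_correct: "card (C - correct) \<le> card V * bal (card W - 1) \<nu>"
proof -
  have "C - correct \<subseteq> (\<Union>x\<in>V. {g \<in> C. \<exists>i\<in>W. g i = x \<and> i \<noteq> r x})"
  proof
    fix g assume g: "g \<in> C - correct"
    then obtain i where "i \<in> W" "r (g i) \<noteq> i" unfolding correct_def by auto
    moreover have "g i \<in> V" using g \<open>i \<in> W\<close> copiesD(2)[of g W lab V i] by blast
    ultimately show "g \<in> (\<Union>x\<in>V. {g \<in> C. \<exists>i\<in>W. g i = x \<and> i \<noteq> r x})"
      using g \<open>i \<in> W\<close> by (intro UN_I[of "g i"]) auto
  qed
  then have "card (C - correct) \<le> card (\<Union>x\<in>V. {g \<in> C. \<exists>i\<in>W. g i = x \<and> i \<noteq> r x})"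
    using finite_V by (intro card_mono) auto
  also have "\<dots> \<le> (\<Sum>x\<in>V. card {g \<in> C. \<exists>i\<in>W. g i = x \<and> i \<noteq> r x})" using finite_V by (rule card_UN_le)
  also have "\<dots> \<le> (\<Sum>x\<in>V. bal (card W - 1) \<nu>)" by (intro sum_mono card_copies_wrong_role)
  finally show ?thesis by simp
qed

lemma correct_eq: "correct = C \<inter> Pi\<^sub>E W cls"
proof
  show "correct \<subseteq> C \<inter> Pi\<^sub>E W cls"
    unfolding correct_def cls_def copies_def by auto
  show "C \<inter> Pi\<^sub>E W cls \<subseteq> correct"
    unfolding correct_def cls_def by (auto dest: PiE_mem)
qed

lemma card_correct_missing: "card correct + card missing = (\<Prod>i\<in>W. card (cls i))"
proof -
  have "card (Pi\<^sub>E W cls) = card (Pi\<^sub>E W cls \<inter> C) + card (Pi\<^sub>E W cls - C)"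
    by (rule card_Int_Diff) simp
  then show ?thesis unfolding correct_eq missing_def using finite_W by (simp add: card_PiE Int_commute)
qed

text \<open>Copies in which a vertex of the class plays \<open>i\<close> are disjoint for different
  vertices, as role \<open>i\<close> is filled once. The errors are wrong-role copies at the
  vertices of the class, and incorrect copies overall.\<close>

lemma class_degree_bound:
  assumes "i \<in> W" and deg: "\<And>x. x \<in> V \<Longrightarrow> D \<le> card {g \<in> C. x \<in> g ` W}"
  shows "card (cls i) * D \<le> card correct + (card V + card (cls i)) * bal (card W - 1) \<nu>"
proof -
  let ?p = "bal (card W - 1) \<nu>"
  have one: "D \<le> card {g \<in> C. g i = x} + ?p" if x: "x \<in> cls i" for x
  proof -
    have xV: "x \<in> V" "r x = i" using x unfolding cls_def by auto
    have "{g \<in> C. x \<in> g ` W} \<subseteq> {g \<in> C. g i = x} \<union> {g \<in> C. \<exists>i\<in>W. g i = x \<and> i \<noteq> r x}"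
      using xV by auto
    then have "card {g \<in> C. x \<in> g ` W} \<le> card ({g \<in> C. g i = x} \<union> {g \<in> C. \<exists>i\<in>W. g i = x \<and> i \<noteq> r x})"
      by (intro card_mono) auto
    also have "\<dots> \<le> card {g \<in> C. g i = x} + card {g \<in> C. \<exists>i\<in>W. g i = x \<and> i \<noteq> r x}" by (rule card_Un_le)
    finally show ?thesis using deg[OF xV(1)] card_copies_wrong_role[OF xV(1)] by linarith
  qed
  have "card (cls i) * D = (\<Sum>x\<in>cls i. D)" by simp
  also have "\<dots> \<le> (\<Sum>x\<in>cls i. card {g \<in> C. g i = x} + ?p)" using one by (rule sum_mono)
  also have "\<dots> = (\<Sum>x\<in>cls i. card {g \<in> C. g i = x}) + card (cls i) * ?p" by (simp add: sum.distrib)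
  also have "(\<Sum>x\<in>cls i. card {g \<in> C. g i = x}) = card (\<Union>x\<in>cls i. {g \<in> C. g i = x})"
    by (intro card_UN_disjoint[symmetric]) auto
  also have "\<dots> \<le> card (correct \<union> (C - correct))"
    unfolding correct_def by (intro card_mono) auto
  also have "\<dots> \<le> card correct + card (C - correct)" by (rule card_Un_le)
  finally show ?thesis using card_not_correct by (simp add: distrib_right)
qed

lemma card_inner: "card inner \<le> (\<Sum>i\<in>W. card (copies W lab (cls i)))"
proof -
  have "inner \<subseteq> (\<Union>i\<in>W. copies W lab (cls i))"
  proof
    fix g assume "g \<in> inner"
    then obtain c where g: "g \<in> C" "c \<in> W" "\<And>i. i \<in> W \<Longrightarrow> r (g i) = c" unfolding inner_def by auto
    then have "g \<in> copies W lab (cls c)" unfolding copies_def cls_def by auto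
    then show "g \<in> (\<Union>i\<in>W. copies W lab (cls i))" using g(2) by blast
  qed
  then have "card inner \<le> card (\<Union>i\<in>W. copies W lab (cls i))"
    using finite_W by (intro card_mono) (auto intro: finite_copies)
  also have "\<dots> \<le> (\<Sum>i\<in>W. card (copies W lab (cls i)))" using finite_W by (rule card_UN_le)
  finally show ?thesis .
qed

lemma card_C_le: "card C \<le> card inner + card crossing + card correct"
proof -
  have "C \<subseteq> inner \<union> crossing \<union> correct" unfolding crossing_def by auto
  then have "card C \<le> card (inner \<union> crossing \<union> correct)"
    by (intro card_mono) (auto simp: inner_def crossing_def correct_def)
  also have "\<dots> \<le> card (inner \<union> crossing) + card correct" by (rule card_Un_le)
  also have "card (inner \<union> crossing) \<le> card inner + card crossing" by (rule card_Un_le)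
  finally show ?thesis by simp
qed

text \<open>At the end \<open>x\<close> where the edge is bad, the role is forced and wrong, so the
  remaining vertices of the copy lie in \<open>bad x\<close>; removing \<open>y\<close> leaves at
  most \<open>\<nu> - 1\<close> candidates for \<open>card W - 2\<close> roles.\<close>

lemma card_copies_bad_edge:
  assumes "e \<in> bad_edges"
  shows "card {g \<in> C. e \<subseteq> g ` W} \<le> bal (card W - 2) (\<nu> - 1)"
proof -
  obtain x y where e: "e = {x, y}" and xy: "x \<in> V" "y \<in> V" "r x \<noteq> r y" and y: "y \<in> bad x"
    using assms unfolding bad_edges_def by auto
  have ne: "x \<noteq> y" using xy by auto
  define i j where "i = lab x y" and "j = lab y x"
  have ij: "i \<in> W" "j \<in> W" "i \<noteq> j" unfolding i_def j_def using lab_in lab_neq xy ne by auto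
  define f where "f l = (if l = i then x else y)" for l
  have "{g \<in> C. e \<subseteq> g ` W} \<subseteq> {g \<in> C. \<forall>l\<in>{i, j}. g l = f l}"
  proof
    fix g assume "g \<in> {g \<in> C. e \<subseteq> g ` W}"
    then have g: "g \<in> C" and "x \<in> g ` W" "y \<in> g ` W" unfolding e by auto
    then obtain i' j' where i': "i' \<in> W" "x = g i'" and j': "j' \<in> W" "y = g j'" by auto
    then have "i' \<noteq> j'" using ne by auto
    then have "i = i'" "j = j'" using copiesD(4)[OF g] i' j' unfolding i_def j_def by auto
    then show "g \<in> {g \<in> C. \<forall>l\<in>{i, j}. g l = f l}" using g i' j' ij unfolding f_def by auto
  qed
  then have "card {g \<in> C. e \<subseteq> g ` W} \<le> card {g \<in> C. \<forall>l\<in>{i, j}. g l = f l}" by (intro card_mono) auto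
  also have "\<dots> \<le> bal (card (W - {i, j})) (card (nb i (f i) - f ` {i, j}))"
    using ij by (intro card_copies_extending) auto
  also have "\<dots> \<le> bal (card W - 2) (\<nu> - 1)"
  proof -
    have "card (W - {i, j}) = card W - 2" using ij finite_W by (simp add: card_Diff_subset)
    moreover have "card (nb i (f i) - f ` {i, j}) \<le> card (bad x - {y})"
    proof (rule card_mono)
      have "i \<noteq> r x" using y unfolding bad_def i_def by simp
      then show "nb i (f i) - f ` {i, j} \<subseteq> bad x - {y}" using nb_subset_bad[of i x] ij unfolding f_def by auto
    qed simp
    moreover have "card (bad x - {y}) \<le> \<nu> - 1" using card_bad[OF xy(1)] y by simp
    ultimately show ?thesis by (simp add: bal_mono)
  qed
  finally show ?thesis .
qed

lemma wrong_role_bad_edge: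
  assumes g: "g \<in> C" and ij: "i \<in> W" "j \<in> W" and ri: "r (g i) \<noteq> i" and rj: "r (g j) \<noteq> r (g i)"
  shows "{g i, g j} \<in> bad_edges"
proof -
  have "i \<noteq> j" using rj by auto
  then have "g j \<in> bad (g i)"
    using copiesD(2)[OF g ij(2)] copiesD(3)[OF g ij] copiesD(4)[OF g ij] ri unfolding bad_def by auto
  then show ?thesis using copiesD(2)[OF g] ij rj unfolding bad_edges_def by fastforce
qed

text \<open>A vertex in a wrong role has a bad edge to every vertex of the copy in another class. If
  there is only one such vertex, all others share a class, and at most one of them has the right
  role.\<close>

lemma two_bad_edges:
  assumes "g \<in> crossing"
  shows "2 \<le> card {e \<in> bad_edges. e \<subseteq> g ` W}"
proof -
  have g: "g \<in> C" and "g \<notin> correct" and ninner: "g \<notin> inner" using assms unfolding crossing_def by auto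
  then obtain i where i: "i \<in> W" "r (g i) \<noteq> i" unfolding correct_def by auto
  define c where "c = r (g i)"
  define J where "J = {j \<in> W. r (g j) \<noteq> c}"
  have cW: "c \<in> W" unfolding c_def using r_in copiesD(2)[OF g i(1)] .
  have fJ: "finite J" using finite_W unfolding J_def by simp
  have inj: "g a = g b \<Longrightarrow> a = b" if "a \<in> W" "b \<in> W" for a b using copiesD(3)[OF g] that by blast
  have two: "2 \<le> card {e \<in> bad_edges. e \<subseteq> g ` W}"
    if "e \<in> bad_edges" "e' \<in> bad_edges" "e \<noteq> e'" "e \<subseteq> g ` W" "e' \<subseteq> g ` W" for e e'
  proof -
    have "card {e, e'} \<le> card {e \<in> bad_edges. e \<subseteq> g ` W}" using that by (intro card_mono) auto
    then show ?thesis using that by simp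
  qed
  have "J \<noteq> {}" using ninner g cW unfolding J_def inner_def by auto
  then obtain j where j: "j \<in> J" by blast
  show ?thesis
  proof (cases "\<exists>l\<in>J. l \<noteq> j")
    case True
    then obtain l where l: "l \<in> J" "l \<noteq> j" by blast
    have W: "j \<in> W" "l \<in> W" using j l unfolding J_def by auto
    have "{g i, g j} \<noteq> {g i, g l}" using inj[OF W] l by (auto simp: doubleton_eq_iff)
    then show ?thesis
      using i j l W unfolding J_def c_def
      by (intro two[of "{g i, g j}" "{g i, g l}"] wrong_role_bad_edge[OF g]) auto
  next
    case False
    have jW: "j \<in> W" "r (g j) \<noteq> c" using j unfolding J_def by auto
    \<comment> \<open>Index \<open>c\<close> is the only one whose role can be right within class
      \<open>c\<close>; four roles leave two wrong ones besides \<open>j\<close>.\<close>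
    have "2 \<le> card (W - {j, c})"
      using card_W diff_card_le_card_Diff[of "{j, c}" W] card_insert_le_m1[of 2 "{c}" j] by fastforce
    then obtain a b where ab: "a \<in> W - {j, c}" "b \<in> W - {j, c}" "a \<noteq> b" by (rule card_ge_2_obtain)
    have rc: "r (g a) = c" "r (g b) = c" using False ab unfolding J_def by auto
    have "{g a, g j} \<noteq> {g b, g j}" using inj[of a b] inj[of a j] ab jW by (auto simp: doubleton_eq_iff)
    then show ?thesis
      using ab rc jW
      by (intro two[of "{g a, g j}" "{g b, g j}"] wrong_role_bad_edge[OF g]) auto
  qed
qed

lemma card_crossing: "2 * card crossing \<le> card bad_edges * bal (card W - 2) (\<nu> - 1)"
proof -
  have fin: "finite crossing" unfolding crossing_def by simp
  have "2 * card crossing = (\<Sum>g\<in>crossing. 2)" by simp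
  also have "\<dots> \<le> (\<Sum>g\<in>crossing. card {e \<in> bad_edges. e \<subseteq> g ` W})" using two_bad_edges by (rule sum_mono)
  also have "\<dots> = (\<Sum>e\<in>bad_edges. card {g \<in> crossing. e \<subseteq> g ` W})"
    by (rule sum_multicount_gen) (use fin in auto)
  also have "\<dots> \<le> (\<Sum>e\<in>bad_edges. bal (card W - 2) (\<nu> - 1))"
  proof (rule sum_mono)
    fix e assume e: "e \<in> bad_edges"
    have "card {g \<in> crossing. e \<subseteq> g ` W} \<le> card {g \<in> C. e \<subseteq> g ` W}"
      by (intro card_mono) (auto simp: crossing_def)
    then show "card {g \<in> crossing. e \<subseteq> g ` W} \<le> bal (card W - 2) (\<nu> - 1)"
      using card_copies_bad_edge[OF e] by linarith
  qed
  finally show ?thesis by simp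
qed

end

section \<open>Crossing copies against lost transversals\<close>

context major_roles
begin

definition role_pairs :: "'b set set" where
  "role_pairs = {P. P \<subseteq> W \<and> card P = 2}"

text \<open>Bad edges between two classes are recorded as partial transversals, so that they extend
  to full ones by gluing functions.\<close>

definition partial_bad :: "'b set \<Rightarrow> ('b \<Rightarrow> 'a) set" where
  "partial_bad P = {f \<in> Pi\<^sub>E P cls. f ` P \<in> bad_edges}"

definition weight :: "'b set \<Rightarrow> nat" where
  "weight P = (\<Prod>i\<in>W - P. card (cls i))"

definition tuples_bad_at :: "'b set \<Rightarrow> ('b \<Rightarrow> 'a) set" where
  "tuples_bad_at P = {g \<in> Pi\<^sub>E W cls. g ` P \<in> bad_edges}"

lemma finite_role_pairs [simp]: "finite role_pairs"
  using finite_W unfolding role_pairs_def by simp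

lemma card_tuples_bad_at:
  assumes "P \<subseteq> W"
  shows "card (tuples_bad_at P) = card (partial_bad P) * weight P"
proof -
  have "tuples_bad_at P =
      {g \<in> Pi\<^sub>E W cls. restrict g P \<in> partial_bad P \<and> restrict g (W - P) \<in> Pi\<^sub>E (W - P) cls}"
    using assms unfolding tuples_bad_at_def partial_bad_def by auto
  also have "card \<dots> = card (partial_bad P) * card (Pi\<^sub>E (W - P) cls)"
    by (rule card_PiE_restrict[OF assms]) (auto simp: partial_bad_def)
  finally show ?thesis unfolding weight_def using finite_W by (simp add: card_PiE)
qed

lemma card_tuples_bad_at_both:
  assumes "P \<subseteq> W"
  shows "card (tuples_bad_at P \<inter> tuples_bad_at (W - P)) = card (partial_bad P) * card (partial_bad (W - P))"
proof -
  have "tuples_bad_at P \<inter> tuples_bad_at (W - P) =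
      {g \<in> Pi\<^sub>E W cls. restrict g P \<in> partial_bad P \<and> restrict g (W - P) \<in> partial_bad (W - P)}"
    using assms unfolding tuples_bad_at_def partial_bad_def by auto
  also have "card \<dots> = card (partial_bad P) * card (partial_bad (W - P))"
    by (rule card_PiE_restrict[OF assms]) (auto simp: partial_bad_def)
  finally show ?thesis .
qed

lemma tuples_bad_at_missing:
  assumes "P \<subseteq> W"
  shows "tuples_bad_at P \<subseteq> missing"
proof
  fix g assume "g \<in> tuples_bad_at P"
  then have g: "g \<in> Pi\<^sub>E W cls" and e: "g ` P \<in> bad_edges" unfolding tuples_bad_at_def by auto
  have "g \<notin> C"
  proof
    assume C: "g \<in> C"
    obtain x y where xy: "g ` P = {x, y}" "r x \<noteq> r y" "y \<in> bad x" using e unfolding bad_edges_def by auto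
    then have "x \<in> g ` P" "y \<in> g ` P" by auto
    then obtain i j where i: "i \<in> P" "x = g i" and j: "j \<in> P" "y = g j" by auto
    then have W: "i \<in> W" "j \<in> W" using assms by auto
    have ri: "r x = i" using PiE_mem[OF g W(1)] i unfolding cls_def by auto
    have "i \<noteq> j" using xy(2) i j by auto
    then have "lab x y = i" using copiesD(4)[OF C W] i j by simp
    then show False using xy(3) ri unfolding bad_def by auto
  qed
  then show "g \<in> missing" using g unfolding missing_def by simp
qed

lemma card_bad_edges: "card bad_edges \<le> (\<Sum>P\<in>role_pairs. card (partial_bad P))"
proof -
  have "bad_edges \<subseteq> (\<Union>P\<in>role_pairs. (\<lambda>f. f ` P) ` partial_bad P)"
  proof
    fix e assume e: "e \<in> bad_edges"
    then obtain x y where xy: "x \<in> V" "y \<in> V" "e = {x, y}" "r x \<noteq> r y" unfolding bad_edges_def by auto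
    define P where "P = {r x, r y}"
    have P: "P \<in> role_pairs" using xy r_in unfolding P_def role_pairs_def by auto
    define f where "f = restrict (\<lambda>i. if i = r x then x else y) P"
    have fP: "f ` P = e" using xy unfolding f_def P_def by auto
    have "f \<in> partial_bad P" unfolding partial_bad_def
      using e fP xy by (auto simp: f_def P_def cls_def)
    then show "e \<in> (\<Union>P\<in>role_pairs. (\<lambda>f. f ` P) ` partial_bad P)" using P fP by blast
  qed
  moreover have fin: "finite (partial_bad P)" if "P \<in> role_pairs" for P
    using that unfolding partial_bad_def role_pairs_def by simp
  ultimately have "card bad_edges \<le> card (\<Union>P\<in>role_pairs. (\<lambda>f. f ` P) ` partial_bad P)"
    by (intro card_mono) auto
  also have "\<dots> \<le> (\<Sum>P\<in>role_pairs. card ((\<lambda>f. f ` P) ` partial_bad P))" by (rule card_UN_le) simp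
  also have "\<dots> \<le> (\<Sum>P\<in>role_pairs. card (partial_bad P))" using fin by (intro sum_mono card_image_le)
  finally show ?thesis .
qed

lemma card_role_pairs: "card role_pairs = card W choose 2"
  unfolding role_pairs_def using n_subsets[OF finite_W] .

text \<open>Each pair \<open>P\<close> separately gives at most \<open>card missing\<close> bad
  tuples, so summing over pairs costs the binomial coefficient; the factor 2 comes from the two bad
  edges in each crossing copy.\<close>

lemma crossing_le_missing:
  assumes w: "\<And>P. P \<in> role_pairs \<Longrightarrow> (card W choose 2) * bal (card W - 2) (\<nu> - 1) \<le> 2 * weight P"
  shows "card crossing \<le> card missing"
proof -
  define c where "c = (card W choose 2)"
  define b where "b = bal (card W - 2) (\<nu> - 1)"
  have "c * (2 * card crossing) \<le> c * (card bad_edges * b)"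
    unfolding b_def by (rule mult_le_mono2[OF card_crossing])
  also have "\<dots> \<le> c * ((\<Sum>P\<in>role_pairs. card (partial_bad P)) * b)"
    using card_bad_edges by (intro mult_le_mono2 mult_le_mono1)
  also have "\<dots> = (\<Sum>P\<in>role_pairs. card (partial_bad P) * (c * b))"
    by (simp add: sum_distrib_left sum_distrib_right mult_ac)
  also have "\<dots> \<le> (\<Sum>P\<in>role_pairs. 2 * card missing)"
  proof (rule sum_mono)
    fix P assume P: "P \<in> role_pairs"
    then have PW: "P \<subseteq> W" unfolding role_pairs_def by simp
    have "card (partial_bad P) * (c * b) \<le> card (partial_bad P) * (2 * weight P)"
      unfolding c_def b_def by (rule mult_le_mono2[OF w[OF P]])
    also have "\<dots> = 2 * card (tuples_bad_at P)" using card_tuples_bad_at[OF PW] by simp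
    also have "\<dots> \<le> 2 * card missing" using tuples_bad_at_missing[OF PW] by (intro mult_le_mono2 card_mono) auto
    finally show "card (partial_bad P) * (c * b) \<le> 2 * card missing" .
  qed
  also have "\<dots> = c * (2 * card missing)" unfolding c_def by (simp add: card_role_pairs)
  finally have "c * (2 * card crossing) \<le> c * (2 * card missing)" .
  moreover have "0 < c" unfolding c_def using card_W by (simp add: zero_less_binomial_iff)
  ultimately show ?thesis by simp
qed

text \<open>For four roles, \<open>P\<close> and \<open>W - P\<close> are disjoint pairs and the tuples bad at \<open>P\<close> and those bad at
  \<open>W - P\<close> are independent events. Counting them together improves on the union bound used above,
  which is too weak in this case.\<close>

lemma crossing_le_missing_4:
  assumes k: "card W = 4" and half: "2 * card missing \<le> (\<Prod>i\<in>W. card (cls i))"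
    and pos: "0 < (\<Prod>i\<in>W. card (cls i))"
    and w: "\<And>P. P \<in> role_pairs \<Longrightarrow> 2 * bal 2 (\<nu> - 1) \<le> weight P"
  shows "card crossing \<le> card missing"
proof -
  define M where "M = (\<Prod>i\<in>W. card (cls i))"
  define m where "m = card missing"
  define b where "b = bal 2 (\<nu> - 1)"
  define t where "t P = card (tuples_bad_at P)" for P
  have comp: "W - P \<in> role_pairs" if "P \<in> role_pairs" for P
    using that k finite_W unfolding role_pairs_def by (auto simp: card_Diff_subset finite_subset)
  \<comment> \<open>By independence the tuples bad at both pairs number t(P) t(W - P) / M. As
    \<open>2 * m \<le> M\<close>, this is at most half of either count, and inclusion-exclusion
    gives 4m/3 instead of 2m.\<close>
  have pair: "3 * (t P + t (W - P)) \<le> 4 * m" if P: "P \<in> role_pairs" for P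
  proof -
    have PW: "P \<subseteq> W" "W - P \<subseteq> W" "W - (W - P) = P" using P unfolding role_pairs_def by auto
    define tt where "tt = card (tuples_bad_at P \<inter> tuples_bad_at (W - P))"
    have fin: "finite (tuples_bad_at Q)" for Q unfolding tuples_bad_at_def by simp
    have un: "t P + t (W - P) = card (tuples_bad_at P \<union> tuples_bad_at (W - P)) + tt"
      unfolding t_def tt_def by (rule card_Un_Int[OF fin fin])
    have "card (tuples_bad_at P \<union> tuples_bad_at (W - P)) \<le> m"
      unfolding m_def using tuples_bad_at_missing[OF PW(1)] tuples_bad_at_missing[OF PW(2)]
      by (intro card_mono) auto
    with un have le: "t P + t (W - P) \<le> m + tt" by simp
    have tm: "t P \<le> m" "t (W - P) \<le> m"
      unfolding m_def t_def using tuples_bad_at_missing[OF PW(1)] tuples_bad_at_missing[OF PW(2)]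
      by (auto intro: card_mono)
    have M: "M = weight P * weight (W - P)"
      unfolding M_def weight_def PW(3) using prod.subset_diff[OF PW(1) finite_W] by simp
    have "t P * t (W - P) = tt * M"
      unfolding t_def tt_def card_tuples_bad_at[OF PW(1)] card_tuples_bad_at[OF PW(2)]
        card_tuples_bad_at_both[OF PW(1)] M by (simp only: mult.assoc mult.left_commute)
    moreover have "2 * m \<le> M" using half unfolding m_def M_def .
    ultimately have "M * (2 * tt) \<le> M * t P" "M * (2 * tt) \<le> M * t (W - P)"
    proof -
      assume e: "t P * t (W - P) = tt * M" and mM: "2 * m \<le> M"
      have "M * (2 * tt) = t P * (2 * t (W - P))" using e by simp
      also have "\<dots> \<le> t P * M" using tm mM by (intro mult_le_mono2) simp
      finally show "M * (2 * tt) \<le> M * t P" by (simp add: mult.commute)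
      have "M * (2 * tt) = t (W - P) * (2 * t P)" using e by (simp add: mult.commute)
      also have "\<dots> \<le> t (W - P) * M" using tm mM by (intro mult_le_mono2) simp
      finally show "M * (2 * tt) \<le> M * t (W - P)" by (simp add: mult.commute)
    qed
    then have "2 * tt \<le> t P" "2 * tt \<le> t (W - P)" using pos unfolding M_def by simp_all
    then have "3 * t P + 3 * t (W - P) \<le> 4 * m" using le by linarith
    then show ?thesis by simp
  qed
  have c6: "card role_pairs = 6" unfolding card_role_pairs k by (simp add: choose_two)
  have "(\<Sum>P\<in>role_pairs. t (W - P)) = (\<Sum>P\<in>role_pairs. t P)"
    by (rule sum.reindex_bij_witness[of _ "\<lambda>P. W - P" "\<lambda>P. W - P"])
      (use comp in \<open>auto simp: role_pairs_def double_diff\<close>)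
  then have "2 * (\<Sum>P\<in>role_pairs. t P) = (\<Sum>P\<in>role_pairs. t P + t (W - P))" by (simp add: sum.distrib)
  then have "6 * (\<Sum>P\<in>role_pairs. t P) = (\<Sum>P\<in>role_pairs. 3 * (t P + t (W - P)))"
    by (simp only: sum_distrib_left[symmetric])
  also have "\<dots> \<le> (\<Sum>P\<in>role_pairs. 4 * m)" using pair by (rule sum_mono)
  finally have tm: "(\<Sum>P\<in>role_pairs. t P) \<le> 4 * m" using c6 by simp
  have "2 * (2 * card crossing) \<le> 2 * (card bad_edges * b)"
    using card_crossing k unfolding b_def by simp
  also have "\<dots> \<le> 2 * ((\<Sum>P\<in>role_pairs. card (partial_bad P)) * b)"
    using card_bad_edges by (intro mult_le_mono2 mult_le_mono1)
  also have "\<dots> = (\<Sum>P\<in>role_pairs. card (partial_bad P) * (2 * b))"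
    by (simp add: sum_distrib_left sum_distrib_right mult_ac)
  also have "\<dots> \<le> (\<Sum>P\<in>role_pairs. t P)"
  proof (rule sum_mono)
    fix P assume P: "P \<in> role_pairs"
    then have PW: "P \<subseteq> W" unfolding role_pairs_def by simp
    show "card (partial_bad P) * (2 * b) \<le> t P"
      unfolding t_def card_tuples_bad_at[OF PW] b_def by (rule mult_le_mono2[OF w[OF P]])
  qed
  finally show ?thesis using tm unfolding m_def by simp
qed

text \<open>One class of \<open>P\<close> is cancelled against the factor \<open>vm\<close> of the
  lower bound for the product, so only the other class costs a factor \<open>u\<close>.\<close>

lemma weight_bound:
  assumes P: "P \<in> role_pairs" and Z: "0 < Z" "0 < vm"
    and vb: "\<And>i. i \<in> W \<Longrightarrow> card (cls i) \<le> vm" "\<And>i. i \<in> W \<Longrightarrow> card (cls i) \<le> u"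
    and M: "vm * Z \<le> (\<Prod>i\<in>W. card (cls i))"
  shows "Z \<le> u * weight P"
proof -
  have PW: "P \<subseteq> W" "card P = 2" using P unfolding role_pairs_def by auto
  then obtain i j where ij: "P = {i, j}" "i \<noteq> j" by (auto simp: card_2_iff)
  have e: "(\<Prod>i\<in>W. card (cls i)) = card (cls i) * (card (cls j) * weight P)"
    unfolding weight_def using prod.subset_diff[OF PW(1) finite_W, of "\<lambda>i. card (cls i)"] ij by simp
  have W: "i \<in> W" "j \<in> W" using ij PW by auto
  have "card (cls i) * Z \<le> vm * Z" using vb(1)[OF W(1)] by (rule mult_le_mono1)
  then have "card (cls i) * Z \<le> card (cls i) * (card (cls j) * weight P)" using M unfolding e by (rule le_trans)
  moreover have "card (cls i) \<noteq> 0"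
  proof
    assume "card (cls i) = 0"
    then show False using M Z unfolding e by simp
  qed
  ultimately have "Z \<le> card (cls j) * weight P" by simp
  also have "\<dots> \<le> u * weight P" using vb(2)[OF W(2)] by (rule mult_le_mono1)
  finally show ?thesis .
qed

end

section \<open>The upper bound\<close>

context major_roles
begin

lemma card_C_le_hb:
  assumes q: "q = (card V - 1) div card W" "1 \<le> q" and \<nu>: "\<nu> = q + q div 20"
    and D: "D = bal (card W - 1) (card V - 1 - q) + 1"
    and deg: "\<And>x. x \<in> V \<Longrightarrow> D \<le> card {g \<in> C. x \<in> g ` W}"
    and IH: "\<And>U. U \<subset> V \<Longrightarrow> card (copies W lab U) \<le> hb (card W) (card U)"
  shows "card C \<le> hb (card W) (card V)"
proof -
  define k where "k = card W"
  define S where "S = card V - 1"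
  define p where "p = bal (k - 1) \<nu>"
  define v where "v i = card (cls i)" for i
  define M where "M = (\<Prod>i\<in>W. v i)"
  have k4: "4 \<le> k" unfolding k_def by (rule card_W)
  have neW: "W \<noteq> {}" using card_W by auto
  have \<nu>20: "20 * \<nu> \<le> 21 * q" using div_times_less_eq_dividend[of q 20] unfolding \<nu> by simp
  have \<nu>1: "1 \<le> \<nu>" using q(2) unfolding \<nu> by simp
  have kq: "k * q \<le> S" unfolding q(1) S_def k_def by simp
  have kqq: "(k - 1) * q \<le> S - q" using kq by (simp add: diff_mult_distrib)
  have "4 * q \<le> k * q" using k4 by (rule mult_le_mono1)
  then have S4: "4 * q \<le> S" using kq by linarith
  have sS: "card V = Suc S" using S4 q(2) unfolding S_def by simp
  have D': "D = bal (k - 1) (S - q) + 1" unfolding D S_def k_def ..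
  have qD: "q ^ (k - 1) < D"
    using bal_ge[of "k - 1" q "S - q - (k - 1) * q" "S - q"] kqq unfolding D' less_Suc_eq_le Suc_eq_plus1[symmetric] by (metis le_add_diff_inverse)
  define X where "X = ((2 * \<nu> - 1) div k + 1) ^ (k - 2)"
  have ex: "q * X + (k + 1) * p \<le> q ^ (k - 1)"
    unfolding X_def p_def by (rule exchange_estimate[OF k4 q(2) \<nu>20])
  \<comment> \<open>For a largest class, \<open>card V\<close> is at most \<open>k * vm\<close>, so
    the error \<open>(card V + vm) * p\<close> of \<open>class_degree_bound\<close> is at most
    \<open>vm * ((k + 1) * p)\<close>. Thus \<open>Z\<close> is the net degree.\<close>
  define Z where "Z = D - (k + 1) * p"
  have ZD: "Z + (k + 1) * p = D" using ex qD unfolding Z_def by linarith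
  have qXZ: "q * X < Z" using ex qD ZD by linarith
  have Z0: "0 < Z" using qXZ by simp

  define vm where "vm = Max (v ` W)"
  have vle: "v i \<le> vm" if "i \<in> W" for i unfolding vm_def by (rule Max_ge) (use that finite_W in auto)
  have "vm \<in> v ` W" unfolding vm_def using finite_W neW by (intro Max_in) auto
  then obtain a where a: "a \<in> W" "v a = vm" by auto
  have vsum: "(\<Sum>i\<in>W. v i) = Suc S" unfolding v_def using sum_card_cls sS by simp
  have skv: "Suc S \<le> k * vm" using sum_bounded_above[of W v vm] vle vsum unfolding k_def by simp
  have vmq: "q < vm"
  proof (rule ccontr)
    assume "\<not> q < vm"
    then have "k * vm \<le> k * q" by (intro mult_le_mono2) simp
    then show False using skv kq by linarith
  qed
  have vm2: "vm \<le> 2 * \<nu> + 1" using card_cls[of a] a unfolding v_def by simp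
  have M: "M = card correct + card missing" unfolding M_def v_def using card_correct_missing by simp
  have corr: "vm * Z \<le> card correct"
  proof -
    have "vm * D \<le> card correct + (Suc S + vm) * p"
      using class_degree_bound[OF a(1) deg] a(2) sS unfolding v_def p_def k_def by simp
    also have "(Suc S + vm) * p \<le> (k * vm + vm) * p" using skv by (intro mult_le_mono1) simp
    also have "(k * vm + vm) * p = vm * ((k + 1) * p)" by (simp add: algebra_simps)
    finally have "vm * D \<le> card correct + vm * ((k + 1) * p)" by simp
    then show ?thesis unfolding ZD[symmetric] by (simp add: distrib_left)
  qed
  then have MZ: "vm * Z \<le> M" using M by simp
  have cross: "card crossing \<le> card missing"
  proof (cases "k = 4")
    case False
    then have k5: "5 \<le> k" using k4 by simp
    show ?thesis
    proof (rule crossing_le_missing)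
      fix P assume P: "P \<in> role_pairs"
      have Zw: "Z \<le> (2 * \<nu> + 1) * weight P"
        using vle vmq card_cls MZ unfolding v_def M_def by (intro weight_bound[OF P Z0, of vm]) auto
      have "even (k * (k - 1))" by (cases "even k") auto
      then have "2 * (k choose 2) = k * (k - 1)"
        unfolding choose_two by (rule dvd_mult_div_cancel)
      then have "2 * ((k choose 2) * bal (k - 2) (\<nu> - 1)) * (2 * \<nu> + 1) = k * (k - 1) * bal (k - 2) (\<nu> - 1) * (2 * \<nu> + 1)"
        by (metis mult.assoc)
      moreover note Zw
      moreover have "k * (k - 1) * bal (k - 2) (\<nu> - 1) * (2 * \<nu> + 1) + 4 * ((k + 1) * p) \<le> 4 * q ^ (k - 1)"
        unfolding p_def by (rule bad_pair_estimate_ge_5[OF k5 q(2) \<nu>20 \<nu>1])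
      ultimately have "2 * ((k choose 2) * bal (k - 2) (\<nu> - 1)) * (2 * \<nu> + 1) \<le> 4 * ((2 * \<nu> + 1) * weight P)"
        using qD ZD by linarith
      then have "(2 * \<nu> + 1) * ((k choose 2) * bal (k - 2) (\<nu> - 1)) \<le> (2 * \<nu> + 1) * (2 * weight P)"
        by (simp add: mult_ac)
      then show "(card W choose 2) * bal (card W - 2) (\<nu> - 1) \<le> 2 * weight P"
        unfolding k_def[symmetric] by (simp only: mult_le_cancel1)
    qed
  next
    case True
    then have W4: "card W = 4" unfolding k_def .
    define u where "u = (q + 3) div 4"
    have k3: "k - 1 = 3" "k + 1 = 5" using True by simp_all
    have S3: "3 * q \<le> S - q" using S4 by simp
    have ZD5: "Z + 5 * p = D" using ZD unfolding k3 .
    have Mv: "M \<le> vm * bal 3 (Suc S - vm)"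
    proof -
      have "M = v a * (\<Prod>i\<in>W - {a}. v i)" unfolding M_def by (rule prod.remove[OF finite_W a(1)])
      moreover have "(\<Prod>i\<in>W - {a}. v i) \<le> bal (card (W - {a})) (\<Sum>i\<in>W - {a}. v i)"
        using finite_W by (intro prod_le_bal) simp
      moreover have "card (W - {a}) = 3" using W4 a(1) finite_W by simp
      moreover have "(\<Sum>i\<in>W - {a}. v i) = Suc S - vm"
        using sum.remove[OF finite_W a(1), of v] a(2) vsum by simp
      ultimately show ?thesis using a(2) by (simp add: mult_le_mono2)
    qed
    have "vm * Z \<le> vm * bal 3 (Suc S - vm)" using MZ Mv by (rule le_trans)
    then have Zb: "Z \<le> bal 3 (Suc S - vm)" using vmq by simp
    have D3: "D = bal 3 (S - q) + 1" using D' unfolding k3 .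
    have vmu: "vm \<le> q + u"
    proof (rule ccontr)
      assume "\<not> vm \<le> q + u"
      then have "bal 3 (Suc S - vm) \<le> bal 3 (S - q - u)" by (intro bal_mono) simp
      moreover have "bal 3 (S - q - u) + 5 * p \<le> bal 3 (S - q)"
        unfolding p_def k3 by (rule class_size_estimate_4[OF q(2) \<nu>20 S3 u_def])
      ultimately show False using Zb ZD5 D3 by linarith
    qed
    show ?thesis
    proof (rule crossing_le_missing_4[OF W4])
      have "M \<le> vm * D"
      proof -
        have "bal 3 (Suc S - vm) \<le> bal 3 (S - q)" using vmq by (intro bal_mono) simp
        then have "vm * bal 3 (Suc S - vm) \<le> vm * D" unfolding D3 by (intro mult_le_mono2) simp
        then show ?thesis by (rule le_trans[OF Mv])
      qed
      also have "\<dots> \<le> vm * (2 * Z)"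
      proof (rule mult_le_mono2)
        have "10 * p \<le> q ^ 3" unfolding p_def k3 by (rule wrong_role_estimate_4[OF \<nu>20])
        then show "D \<le> 2 * Z" using ZD5 qD unfolding k3 by linarith
      qed
      also have "\<dots> \<le> 2 * card correct" using corr by simp
      finally show "2 * card missing \<le> (\<Prod>i\<in>W. card (cls i))"
        using M unfolding M_def v_def by linarith
      have "0 < vm * Z" using vmq Z0 by simp
      then show "0 < (\<Prod>i\<in>W. card (cls i))" using MZ unfolding M_def v_def by linarith
      fix P assume P: "P \<in> role_pairs"
      have "Z \<le> (q + u) * weight P"
        using vle vmq vmu MZ unfolding v_def M_def
        by (intro weight_bound[OF P Z0, of vm]) (auto intro: le_trans)
      moreover have "2 * bal 2 (\<nu> - 1) * (q + u) + 5 * p \<le> q ^ 3"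
        unfolding p_def k3 by (rule bad_pair_estimate_4[OF q(2) \<nu>20 \<nu>1 u_def])
      ultimately have "2 * bal 2 (\<nu> - 1) * (q + u) \<le> (q + u) * weight P"
        using ZD5 qD unfolding k3 by linarith
      then have "(q + u) * (2 * bal 2 (\<nu> - 1)) \<le> (q + u) * weight P" by (simp only: mult.commute)
      then show "2 * bal 2 (\<nu> - 1) \<le> weight P" using q(2) by (simp only: mult_le_cancel1)
    qed
  qed
  have "card inner \<le> (\<Sum>i\<in>W. hb k (v i))"
  proof -
    have "card (copies W lab (cls i)) \<le> hb k (v i)" if "i \<in> W" for i
    proof -
      \<comment> \<open>A class has at most 2.1q + 1 vertices while \<open>V\<close> has at least 4q
        + 1, so every class is a proper subset and the induction hypothesis applies.\<close>
      have "q div 20 * 20 \<le> q" by (rule div_times_less_eq_dividend)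
      then have "2 * \<nu> + 1 < Suc S" using S4 q(2) unfolding \<nu> by simp
      then have "cls i \<noteq> V" using card_cls[of i] sS by auto
      then have "cls i \<subset> V" using cls_subset by blast
      then show ?thesis unfolding k_def v_def by (rule IH)
    qed
    then show ?thesis using card_inner sum_mono[of W "\<lambda>i. card (copies W lab (cls i))" "\<lambda>i. hb k (v i)"]
      by (meson le_trans)
  qed
  then have "card C \<le> (\<Sum>i\<in>W. hb k (v i)) + M" using card_C_le cross M by linarith
  also have "\<dots> \<le> hb k (sum v W)"
    unfolding M_def
  proof (rule hb_exchange[OF finite_W k_def[symmetric] _ _ q(2)])
    show "2 \<le> k" using k4 by simp
    show "q = (sum v W - 1) div k" using q(1) vsum unfolding S_def k_def by simp
    show "v i \<le> 2 * \<nu> + 1" for i unfolding v_def by (rule card_cls)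
    show "((2 * \<nu> + 1 - 2) div k + 1) ^ (k - 2) \<le> X" unfolding X_def by simp
    fix i assume i: "i \<in> W"
    have "v i * (q * X) \<le> vm * Z" using vle[OF i] qXZ by (intro mult_le_mono) auto
    then show "v i * (q * X) \<le> (\<Prod>i\<in>W. v i)" using MZ unfolding M_def by simp
  qed
  finally show ?thesis using vsum sS unfolding k_def by simp
qed

end

lemma card_copies_le_hb:
  fixes V :: "'a set" and W :: "'b set"
  assumes "role_labelling W V lab" and k: "4 \<le> card W"
  shows "card (copies W lab V) \<le> hb (card W) (card V)"
  using assms(1)
proof (induction "card V" arbitrary: V rule: less_induct)
  case less
  interpret role_labelling W V lab by (rule less.prems)
  have IH: "card (copies W lab U) \<le> hb (card W) (card U)" if "U \<subset> V" for U
  proof (rule less.hyps)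
    show "card U < card V" using that finite_V by (rule psubset_card_mono[rotated])
    show "role_labelling W U lab"
    proof
      show "finite W" by (rule finite_W)
      show "finite U" using that finite_V by (auto intro: finite_subset)
      fix x y assume xy: "x \<in> U" "y \<in> U" "x \<noteq> y"
      then have "x \<in> V" "y \<in> V" using that by auto
      then show "lab x y \<in> W" "lab x y \<noteq> lab y x" using lab_in lab_neq xy(3) by blast+
    qed
  qed
  show ?case
  proof (rule ccontr)
    assume "\<not> ?thesis"
    then have big: "hb (card W) (card V) < card C" by simp
    have "V \<noteq> {}"
    proof
      assume "V = {}"
      then have "C = {}" using k copiesD(2)[of _ W lab V] by fastforce
      then show False using big by simp
    qed
    then have cV: "card V = Suc (card V - 1)" using finite_V by (simp add: card_gt_0_iff)
    define S where "S = card V - 1"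
    define q where "q = S div card W"
    define D where "D = bal (card W - 1) (S - q) + 1"
    have deg: "D \<le> card {g \<in> C. x \<in> g ` W}" if x: "x \<in> V" for x
    proof -
      have "C \<subseteq> copies W lab (V - {x}) \<union> {g \<in> C. x \<in> g ` W}"
        unfolding copies_def by (auto simp: PiE_iff)
      then have "card C \<le> card (copies W lab (V - {x}) \<union> {g \<in> C. x \<in> g ` W})"
        using finite_W finite_V by (intro card_mono) (auto intro: finite_copies)
      also have "\<dots> \<le> card (copies W lab (V - {x})) + card {g \<in> C. x \<in> g ` W}" by (rule card_Un_le)
      also have "card (copies W lab (V - {x})) \<le> hb (card W) S"
        using IH[of "V - {x}"] x finite_V unfolding S_def by auto
      finally have "hb (card W) (card V) < hb (card W) S + card {g \<in> C. x \<in> g ` W}" using big by simp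
      moreover have "hb (card W) (card V) = hb (card W) S + dl (card W) S"
        using cV hb_Suc[of "card W" S] unfolding S_def by simp
      \<comment> \<open>The recursive term \<open>dl (card W) q\<close> is discarded; the
        \<open>+ 1\<close> in \<open>D\<close> comes from the strict inequality of the
        counterexample.\<close>
      moreover have "bal (card W - 1) (S - q) \<le> dl (card W) S"
        using dl_eq[of "card W" S] k unfolding q_def by simp
      ultimately show ?thesis unfolding D_def by linarith
    qed
    have deg': "bal (card W - 1) (S - q) < (\<Sum>i\<in>W. bal (card W - 1) (card (nb i x)))" if "x \<in> V" for x
      using deg[OF that] card_copies_containing[of x] unfolding D_def by linarith
    \<comment> \<open>For \<open>q = 0\<close> superadditivity alone bounds every degree by
      \<open>bal (card W - 1) S\<close>, so a minimal counterexample has more than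
      \<open>card W\<close> vertices.\<close>
    have q1: "1 \<le> q"
    proof (rule ccontr)
      assume "\<not> 1 \<le> q"
      then have q0: "q = 0" by simp
      obtain x where x: "x \<in> V" using \<open>V \<noteq> {}\<close> by blast
      have "(\<Sum>i\<in>W. bal (card W - 1) (card (nb i x))) \<le> bal (card W - 1) S"
        using bal_sum_le[OF finite_W, of "card W - 1" "\<lambda>i. card (nb i x)"] k sum_card_nb[OF x]
        unfolding S_def by simp
      then show False using deg'[OF x] q0 by simp
    qed
    have "\<exists>i\<in>W. S \<le> card (nb i x) + (q + q div 20)" if x: "x \<in> V" for x
      by (rule exists_major_role[OF finite_W refl k _ q_def q1 deg'[OF x]])
        (simp add: sum_card_nb[OF x] S_def)
    then obtain r where r: "\<And>x. x \<in> V \<Longrightarrow> r x \<in> W \<and> S \<le> card (nb (r x) x) + (q + q div 20)"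
      by metis
    interpret major_roles W V lab r "q + q div 20"
      using r k unfolding S_def by unfold_locales auto
    have "card C \<le> hb (card W) (card V)"
    proof (rule card_C_le_hb)
      show "q = (card V - 1) div card W" unfolding q_def S_def ..
      show "D = bal (card W - 1) (card V - 1 - q) + 1" unfolding D_def S_def ..
    qed (use q1 deg IH in auto)
    then show False using big by simp
  qed
qed

section \<open>From coloured tournaments to role labellings\<close>

theorem theorem2p1:
  fixes V :: "'a set" and T :: "'a \<Rightarrow> 'a \<Rightarrow> bool" and colH :: "'a set \<Rightarrow> nat set"
    and W :: "'b set" and TR :: "'b \<Rightarrow> 'b \<Rightarrow> bool" and colR :: "'b set \<Rightarrow> nat set"
    and k s :: nat
  assumes "4 \<le> k" and "k \<le> s"
    and "tournament W TR" and "card W = k"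
    and "bij_betw colR (edges W) (kpairs k)"
    and "tournament V T" and "card V = s"
    and "\<forall>e\<in>edges V. colH e \<in> kpairs k"
  shows "card {K. is_copy V T colH W TR colR K} \<le> gk k s"
proof -
  have finW: "finite W" and TR: "\<And>a b. a \<in> W \<Longrightarrow> b \<in> W \<Longrightarrow> a \<noteq> b \<Longrightarrow> TR a b \<longleftrightarrow> \<not> TR b a"
    using assms(3) unfolding tournament_def by blast+
  have finV: "finite V" and T: "\<And>x y. x \<in> V \<Longrightarrow> y \<in> V \<Longrightarrow> x \<noteq> y \<Longrightarrow> T x y \<longleftrightarrow> \<not> T y x"
    using assms(6) unfolding tournament_def by blast+
  have injR: "inj_on colR (edges W)" and imR: "colR ` edges W = kpairs k"
    using assms(5) unfolding bij_betw_def by auto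
  \<comment> \<open>The colours of \<open>R\<close> being distinct, the colour of an edge determines
    the unordered pair of roles, and the orientation determines its order. Hence the choice in
    \<open>lab\<close> below is forced.\<close>
  define plays where "plays x y a b \<longleftrightarrow>
    a \<in> W \<and> b \<in> W \<and> a \<noteq> b \<and> colR {a, b} = colH {x, y} \<and> (T x y \<longleftrightarrow> TR a b)" for x y a b
  define lab where "lab x y = (SOME a. \<exists>b. plays x y a b)" for x y
  have unique: "a = a'" if "plays x y a b" "plays x y a' b'" for x y a b a' b'
  proof -
    have "{a, b} \<in> edges W" "{a', b'} \<in> edges W" "colR {a, b} = colR {a', b'}"
      using that unfolding plays_def edges_def by auto
    then have "{a, b} = {a', b'}" using injR by (auto dest: inj_onD)
    then consider "a = a'" | "a = b'" "b = a'" by (auto simp: doubleton_eq_iff)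
    then show ?thesis
    proof cases
      case 2
      then show ?thesis using that TR[of a b] unfolding plays_def by blast
    qed
  qed
  have lab_eq: "lab x y = a" if "plays x y a b" for x y a b
  proof -
    have "\<exists>a b. plays x y a b" using that by blast
    then have "\<exists>b. plays x y (lab x y) b" unfolding lab_def by (rule someI_ex)
    then obtain b' where "plays x y (lab x y) b'" ..
    then show ?thesis using that by (rule unique)
  qed
  have sym: "plays y x b a" if "plays x y a b" "x \<in> V" "y \<in> V" "x \<noteq> y" for x y a b
  proof -
    have "{b, a} = {a, b}" "{y, x} = {x, y}" by auto
    then show ?thesis using that T[of x y] TR[of a b] unfolding plays_def by metis
  qed
  have ex: "\<exists>a b. plays x y a b" if xy: "x \<in> V" "y \<in> V" "x \<noteq> y" for x y
  proof -
    have "{x, y} \<in> edges V" using xy unfolding edges_def by auto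
    then have "colH {x, y} \<in> colR ` edges W" using assms(8) imR by auto
    then obtain e where e: "e \<in> edges W" "colR e = colH {x, y}" by auto
    then obtain a b where ab: "e = {a, b}" "a \<noteq> b" unfolding edges_def by (auto simp: card_2_iff)
    have W: "a \<in> W" "b \<in> W" using e(1) ab unfolding edges_def by auto
    have "{b, a} = {a, b}" by auto
    then have "plays x y a b \<or> plays x y b a"
      using W ab e(2) TR[OF W ab(2)] unfolding plays_def by metis
    then show ?thesis by blast
  qed
  have rl: "role_labelling W V lab"
  proof
    show "finite W" "finite V" by (rule finW, rule finV)
    fix x y assume xy: "x \<in> V" "y \<in> V" "x \<noteq> y"
    obtain a b where ab: "plays x y a b" using ex[OF xy] by blast
    have "lab x y = a" "lab y x = b" using lab_eq ab sym[OF ab xy] by auto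
    then show "lab x y \<in> W" "lab x y \<noteq> lab y x" using ab unfolding plays_def by auto
  qed
  \<comment> \<open>A copy is the image of the inverse of its isomorphism onto \<open>R\<close>; for
    an upper bound it is enough that role assignments cover all copies.\<close>
  have "{K. is_copy V T colH W TR colR K} \<subseteq> (\<lambda>g. g ` W) ` copies W lab V"
  proof
    fix K assume "K \<in> {K. is_copy V T colH W TR colR K}"
    then obtain f where KV: "K \<subseteq> V" and f: "bij_betw f K W"
      and pres: "\<And>u v. u \<in> K \<Longrightarrow> v \<in> K \<Longrightarrow> u \<noteq> v \<Longrightarrow> (T u v \<longleftrightarrow> TR (f u) (f v)) \<and> colH {u, v} = colR {f u, f v}"
      unfolding is_copy_def by blast
    define h where "h = inv_into K f"
    have h: "bij_betw h W K" unfolding h_def using f by (rule bij_betw_inv_into)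
    have fh: "f (h i) = i" if "i \<in> W" for i
      unfolding h_def using that f by (intro f_inv_into_f) (simp add: bij_betw_def)
    have hK: "h i \<in> K" if "i \<in> W" for i using bij_betwE[OF h] that by blast
    have pl: "h i \<noteq> h j \<and> lab (h i) (h j) = i" if ij: "i \<in> W" "j \<in> W" "i \<noteq> j" for i j
    proof -
      have ne: "h i \<noteq> h j" using fh[OF ij(1)] fh[OF ij(2)] ij(3) by auto
      have "plays (h i) (h j) i j"
        using pres[OF hK[OF ij(1)] hK[OF ij(2)] ne] ij fh unfolding plays_def by simp
      then show ?thesis using ne lab_eq by blast
    qed
    have "restrict h W \<in> copies W lab V"
      unfolding copies_def using hK KV pl by auto
    moreover have "restrict h W ` W = K" using h by (simp add: bij_betw_def)
    ultimately show "K \<in> (\<lambda>g. g ` W) ` copies W lab V" by blast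
  qed
  then have "card {K. is_copy V T colH W TR colR K} \<le> card (copies W lab V)"
    by (rule surj_card_le[OF finite_copies[OF finW finV]])
  also have "\<dots> \<le> hb k s" using card_copies_le_hb[OF rl] assms(1,4,7) by simp
  also have "\<dots> \<le> gk k s" using assms(1) by (intro hb_le_gk) simp
  finally show ?thesis .
qed

end
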